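(* Let $\mu_{i,j}$ ($i,j\in\mathbb{N}$) be skew-symmetric bi-moments depending smoothly on times $t=(t_1,t_2,\ldots)$ with $$\partial_{t_n}\mu_{i,j}=\mu_{i+n,j}+\mu_{i,j+n}\quad (n\ge1,\ i,j\in\mathbb{N}),\qquad \mu_{i,j}=\mu_{i-1,j-1}\quad (i,j\ge1),$$ and assume $\tau_{2n}\neq0$ for all $n\in\mathbb{N}$. Then for all $n\in\mathbb{N}$ and $0\le\ell\le 2n$ the tau functions satisfy (1d-Toda hierarchy) $$D_{t_1}\,\tau_{2n}\cdot \left(s_{2n-\ell}(-\tilde{\partial}_t)\tau_{2n}\right)=\tau_{2n+2}\,s_{2n-1-\ell}(-\tilde{\partial}_t)\tau_{2n-2}.$$
   Context: $\mathbb{N}=\{0,1,2,\ldots\}$; $\mu_{i,j}=-\mu_{j,i}$ are real-valued. $\tau_{2n}=\mathrm{Pf}(0,1,\ldots,2n-1)$ is the Pfaffian of the $2n\times2n$ skew-symmetric matrix $(\mu_{a,b})_{a,b=0}^{2n-1}$, with $\tau_0=1$ and the convention $\tau_{-2}=0$. The (elementary) Schur polynomials $s_k$ are defined by $\exp\left(\sum_{l\ge1}t_l z^l\right)=\sum_{k\ge0}s_k(t)z^k$, with $s_k=0$ for $k<0$; $\tilde\partial_t=(\partial_{t_1},\tfrac12\partial_{t_2},\tfrac13\partial_{t_3},\ldots)$, and $s_k(-\tilde\partial_t)$ is the differential operator obtained by substituting $t_l\mapsto-\tfrac1l\partial_{t_l}$ in $s_k$. Hirota's bilinear operator is $D_{t}f\cdot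 g=(\partial_{t}f)g-f\,\partial_{t}g$. *)

theory Defs
  imports "HOL-Analysis.Analysis"
    "HOL-Library.Poly_Mapping"
    "HOL-Computational_Algebra.Formal_Power_Series"
begin

text \<open>
  A point \<open>t = (t\<^sub>1, t\<^sub>2, \<dots>)\<close> in the space of times is a function on the natural numbers whose
  value at index \<open>0\<close> plays no role: no derivative is ever taken in that direction.
\<close>

type_synonym times = "nat \<Rightarrow> real"

definition time_slice :: "nat \<Rightarrow> times \<Rightarrow> times set" where
  "time_slice N t = {s. \<forall>l. l \<notin> {1..N} \<longrightarrow> s l = t l}"

text \<open>
  The times range over a set that is open in every finite collection of the variables. All
  sequences, or all finitely supported ones, form such a set, and so do smaller
  domains on which given moments converge.
\<close>

definition times_domain :: "times set \<Rightarrow> bool" where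
  "times_domain T \<longleftrightarrow>
     (\<forall>N t. openin (top_of_set (time_slice N t)) (T \<inter> time_slice N t))"

definition time_deriv :: "nat \<Rightarrow> (times \<Rightarrow> real) \<Rightarrow> times \<Rightarrow> real" where
  "time_deriv l f t = deriv (\<lambda>x. f (t(l := x))) (t l)"

text \<open>
  Smoothness in infinitely many variables means that the function is smooth in each finite
  collection of them: all iterated partial derivatives exist and are jointly continuous in
  any finitely many times.
\<close>

definition smooth_in_times :: "times set \<Rightarrow> (times \<Rightarrow> real) \<Rightarrow> bool" where
  "smooth_in_times T f \<longleftrightarrow>
     (\<forall>ls. (\<forall>l\<in>set ls. l \<ge> 1) \<longrightarrow>
        (\<forall>N t. continuous_on (T \<inter> time_slice N t) (foldr time_deriv ls f)) \<and>
        (\<forall>l\<ge>1. \<forall>t\<in>T. (\<lambda>x. foldr time_deriv ls f (t(l := x))) differentiable (at (t l))))"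

definition hirota :: "nat \<Rightarrow> (times \<Rightarrow> real) \<Rightarrow> (times \<Rightarrow> real) \<Rightarrow> times \<Rightarrow> real" where
  "hirota l f g t = time_deriv l f t * g t - f t * time_deriv l g t"

text \<open>
  Polynomials in the variables \<open>t\<^sub>0, t\<^sub>1, \<dots>\<close>: finitely supported maps from exponent vectors to
  coefficients.
\<close>

type_synonym time_poly = "(nat \<Rightarrow>\<^sub>0 nat) \<Rightarrow>\<^sub>0 real"

definition poly_const :: "real \<Rightarrow> time_poly" where
  "poly_const c = Poly_Mapping.single 0 c"

definition poly_var :: "nat \<Rightarrow> time_poly" where
  "poly_var l = Poly_Mapping.single (Poly_Mapping.single l 1) 1"

text \<open>The power series \<open>exp (\<Sum>l\<ge>1. t\<^sub>l z\<^sup>l)\<close> in \<open>z\<close>, with polynomials as coefficients.\<close>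

definition schur_gf :: "time_poly fps" where
  "schur_gf =
     fps_compose (Abs_fps (\<lambda>m. poly_const (1 / fact m)))
       (Abs_fps (\<lambda>l. if l = 0 then 0 else poly_var l))"

definition schur_poly :: "int \<Rightarrow> time_poly" where
  "schur_poly k = (if k < 0 then 0 else fps_nth schur_gf (nat k))"

text \<open>
  Substitution of operators \<open>X\<^sub>0, X\<^sub>1, \<dots>\<close> for the variables of a polynomial, with the
  result applied to a function. In each monomial the operators are composed in increasing
  order of the index; the operators used below commute on smooth functions.
\<close>

definition poly_subst_op ::
  "(nat \<Rightarrow> (times \<Rightarrow> real) \<Rightarrow> times \<Rightarrow> real) \<Rightarrow> time_poly \<Rightarrow> (times \<Rightarrow> real) \<Rightarrow> times \<Rightarrow> real" where
  "poly_subst_op X p f t =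
     (\<Sum>m\<in>Poly_Mapping.keys p. Poly_Mapping.lookup p m *
        foldr (\<lambda>l. X l ^^ Poly_Mapping.lookup m l) (sorted_list_of_set (Poly_Mapping.keys m)) f t)"

text \<open>The operator obtained from \<open>s\<^sub>k\<close>, where \<open>t\<^sub>l\<close> is replaced by \<open>-1/l\<close> times the derivative in \<open>t\<^sub>l\<close>.\<close>

definition schur_op :: "int \<Rightarrow> (times \<Rightarrow> real) \<Rightarrow> times \<Rightarrow> real" where
  "schur_op k = poly_subst_op (\<lambda>l g t. - (1 / real l) * time_deriv l g t) (schur_poly k)"

text \<open>The Pfaffian of the skew-symmetric matrix \<open>(A a b)\<close> with \<open>0 \<le> a, b < 2 * n\<close>.\<close>

definition pfaffian :: "nat \<Rightarrow> (nat \<Rightarrow> nat \<Rightarrow> real) \<Rightarrow> real" where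
  "pfaffian n A =
     (\<Sum>p | p permutes {..<2 * n}.
        of_int (sign p) * (\<Prod>i<n. A (p (2 * i)) (p (2 * i + 1)))) / (2 ^ n * fact n)"

text \<open>
  Only even indices occur: \<open>tau \<mu> n\<close> stands for \<open>\<tau>\<close> with index \<open>2 * n\<close>. The index is an
  integer so that \<open>tau \<mu> (-1) = 0\<close> is available.
\<close>

definition tau :: "(nat \<Rightarrow> nat \<Rightarrow> times \<Rightarrow> real) \<Rightarrow> int \<Rightarrow> times \<Rightarrow> real" where
  "tau \<mu> n t = (if n < 0 then 0 else pfaffian (nat n) (\<lambda>a b. \<mu> a b t))"

end

theory Submission
  imports Defs
begin

text \<open>
  The Pfaffian of index lists is multilinear, so a polynomial in variables \<open>x\<^sub>0, \<dots>, x\<^sub>2\<^sub>n\<^sub>-\<^sub>1\<close> acts on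
  \<open>\<tau>\<^sub>2\<^sub>n\<close> by letting \<open>x\<^sub>j\<close> raise the \<open>j\<close>-th index, and the evolution equation says that the derivative
  in \<open>t\<^sub>l\<close> is the action of the \<open>l\<close>-th power sum. Substituting \<open>- 1/l\<close> times the power sums in the Schur
  generating series gives \<open>\<Prod>\<^sub>j (1 - x\<^sub>j z)\<close>, because both series solve the same linear differential
  equation. Hence \<open>s\<^sub>k\<close> acts on \<open>\<tau>\<^sub>2\<^sub>n\<close> as \<open>(-1)\<^sup>k\<close> times the \<open>k\<close>-th elementary symmetric polynomial, and as
  Pfaffians with a repeated index vanish, only one term survives: the Pfaffian of
  \<open>0, \<dots>, 2n\<close> without \<open>2n - k\<close>.
  With \<open>K = {1, \<dots>, 2n - 1} - {\<ell>}\<close>, the Toda equation is then the Pluecker relation between the Pfaffians of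
  \<open>K\<close> extended by subsets of \<open>{0, \<ell>, 2n, 2n + 1}\<close>, after shifting all indices of some factors down by one.
\<close>

section \<open>Expansion of the Pfaffian along its first row\<close>

abbreviation swap :: "nat \<Rightarrow> nat \<Rightarrow> nat \<Rightarrow> nat" where
  "swap \<equiv> Transposition.transpose"

definition pf_weight :: "nat \<Rightarrow> (nat \<Rightarrow> nat \<Rightarrow> real) \<Rightarrow> (nat \<Rightarrow> nat) \<Rightarrow> real" where
  "pf_weight n A p = of_int (sign p) * (\<Prod>i<n. A (p (2 * i)) (p (2 * i + 1)))"

lemma pfaffian_weight:
  "pfaffian n A = (\<Sum>p | p permutes {..<2 * n}. pf_weight n A p) / (2 ^ n * fact n)"
  by (simp add: pfaffian_def pf_weight_def)

lemma permutes_permutation: "p permutes {..<k::nat} \<Longrightarrow> permutation p"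
  by (rule permutes_imp_permutation) auto

text \<open>Conjugation with the shift by 2 identifies the permutations of the last
  \<open>2 * m\<close> positions with those of \<open>{..<2 * m}\<close>. This is what remains of
  the sum once a permutation fixes 0 and 1.\<close>

lemma sum_permutes_shift:
  fixes m :: nat
  shows "(\<Sum>p | p permutes {2..<2 * m + 2}. g p) =
   (\<Sum>p | p permutes {..<2 * m}. g (map_permutation {..<2 * m} (\<lambda>x. x + 2) p))"
proof -
  have bij: "bij_betw (\<lambda>x. x + 2) {..<2 * m} {2..<2 * m + 2}"
    by (rule bij_betwI[of _ _ _ "\<lambda>x. x - 2"]) auto
  have bij': "bij_betw (\<lambda>x. x - 2) {2..<2 * m + 2} {..<2 * m}"
    by (rule bij_betwI[of _ _ _ "\<lambda>x. x + 2"]) auto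
  show ?thesis
    by (rule sum.reindex_bij_witness[of _ "map_permutation {..<2 * m} (\<lambda>x. x + 2)"
          "map_permutation {2..<2 * m + 2} (\<lambda>x. x - 2)"])
      (use map_permutation_permutes[OF bij] map_permutation_permutes[OF bij']
         map_permutation_compose_inv[OF bij] map_permutation_compose_inv[OF bij'] in
        \<open>auto simp del: add_2_eq_Suc'\<close>)
qed

text \<open>The sign of the transposition cancels against the sign from the skew symmetry of
  \<open>A\<close>.\<close>

lemma pf_weight_swap_in_pair:
  assumes "p permutes {..<2 * Suc m}" and "\<And>a b. a < 2 * Suc m \<Longrightarrow> b < 2 * Suc m \<Longrightarrow> A a b = - A b a"
  shows "pf_weight (Suc m) A (p \<circ> swap 0 1) = pf_weight (Suc m) A p"
proof -
  have s: "sign (p \<circ> swap 0 1) = - sign p"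
    using assms(1) by (simp add: sign_compose permutes_permutation permutation_swap_id sign_swap_id)
  have 1: "A (p 1) (p 0) = - A (p 0) (p 1)"
    by (rule assms(2)) (use permutes_in_image[OF assms(1)] in auto)
  show ?thesis
    unfolding pf_weight_def s prod.lessThan_Suc_shift
    using 1 by (simp add: Transposition.transpose_def)
qed

text \<open>Exchanging two whole pairs is a product of two transpositions, hence even, and only
  reorders the factors of the product.\<close>

lemma pf_weight_swap_pairs:
  assumes "p permutes {..<2 * Suc m}" and "k < Suc m" "k > 0"
  shows "pf_weight (Suc m) A (p \<circ> (swap 0 (2 * k) \<circ> swap 1 (2 * k + 1))) = pf_weight (Suc m) A p"
proof -
  let ?r = "swap 0 (2 * k) \<circ> swap 1 (2 * k + 1)"
  have s: "sign (p \<circ> ?r) = sign p"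
    using assms by (simp add: sign_compose permutes_permutation permutation_swap_id permutation_compose sign_swap_id)
  have r: "?r (2 * i) = 2 * swap 0 k i" "?r (2 * i + 1) = 2 * swap 0 k i + 1" for i
    using assms(3) by (auto simp: Transposition.transpose_def)
  have "(\<Prod>i<Suc m. A ((p \<circ> ?r) (2 * i)) ((p \<circ> ?r) (2 * i + 1))) = 
     (\<Prod>i<Suc m. A (p (2 * swap 0 k i)) (p (2 * swap 0 k i + 1)))"
    using r by simp
  also have "\<dots> = (\<Prod>i<Suc m. A (p (2 * i)) (p (2 * i + 1)))"
    using prod.permute[of "swap 0 k" "{..<Suc m}" "\<lambda>i. A (p (2 * i)) (p (2 * i + 1))"] assms
    by (simp add: permutes_swap_id o_def del: prod.lessThan_Suc)
  finally show ?thesis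
    unfolding pf_weight_def s by simp
qed

text \<open>The value 0 is taken at exactly one of the \<open>2 * Suc m\<close> positions
  \<open>q\<close>. The part of the sum with \<open>p q = 0\<close> does not depend on
  \<open>q\<close>, because \<open>q\<close> can be moved to position 0 without changing
  weights.\<close>

lemma sum_weight_first_fixed:
  assumes skew: "\<And>a b. a < 2 * Suc m \<Longrightarrow> b < 2 * Suc m \<Longrightarrow> A a b = - A b a"
  shows "(\<Sum>p | p permutes {..<2 * Suc m}. pf_weight (Suc m) A p) =
    real (2 * Suc m) * (\<Sum>p | p permutes {..<2 * Suc m}. if p 0 = 0 then pf_weight (Suc m) A p else 0)"
proof -
  let ?N = "2 * Suc m" and ?S = "{p. p permutes {..<2 * Suc m}}"
  let ?w = "pf_weight (Suc m) A"
  \<comment> \<open>Exchange the first pair with the pair containing \<open>q\<close>; for odd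
    \<open>q\<close>, also swap the two places of the first pair.\<close>
  have ex: "\<exists>r. r permutes {..<?N} \<and> r 0 = q \<and> (\<forall>p\<in>?S. ?w (p \<circ> r) = ?w p)" if q: "q < ?N" for q
  proof -
    define r where "r k = (if k = 0 then id else swap 0 (2 * k) \<circ> swap 1 (2 * k + 1))" for k :: nat
    have rp: "r k permutes {..<?N}" if "k < Suc m" for k
      using that unfolding r_def by (auto intro!: permutes_compose permutes_swap_id permutes_id)
    have rw: "?w (p \<circ> r k) = ?w p" if "k < Suc m" "p \<in> ?S" for p k
      using that pf_weight_swap_pairs[of p m k A] unfolding r_def by auto
    have r0: "r k 0 = 2 * k" "r k 1 = 2 * k + 1" for k by (auto simp: r_def)
    have k: "q div 2 < Suc m" using q by auto
    show ?thesis
    proof (cases "even q")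
      case True
      then show ?thesis using rp[OF k] rw[OF k] r0[of "q div 2"] by (intro exI[of _ "r (q div 2)"]) auto
    next
      case False
      let ?r = "r (q div 2) \<circ> swap 0 1"
      have "?w (p \<circ> ?r) = ?w p" if "p \<in> ?S" for p
      proof -
        have "p \<circ> r (q div 2) permutes {..<?N}"
          using that rp[OF k] by (auto intro: permutes_compose)
        from pf_weight_swap_in_pair[OF this skew] have "?w ((p \<circ> r (q div 2)) \<circ> swap 0 1) = ?w (p \<circ> r (q div 2))" by simp
        with rw[OF k that] show ?thesis by (simp add: comp_assoc)
      qed
      moreover have "?r permutes {..<?N}"
        using rp[OF k] by (intro permutes_compose permutes_swap_id) auto
      moreover have "?r 0 = q" using r0[of "q div 2"] False by simp
      ultimately show ?thesis by blast
    qed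
  qed
  have const: "(\<Sum>p\<in>?S. if p q = 0 then ?w p else 0) = (\<Sum>p\<in>?S. if p 0 = 0 then ?w p else 0)"
    if "q < ?N" for q
  proof -
    from ex[OF that] obtain r where r: "r permutes {..<?N}" "r 0 = q" "\<And>p. p \<in> ?S \<Longrightarrow> ?w (p \<circ> r) = ?w p" by blast
    have "(\<Sum>p\<in>?S. if p 0 = 0 then ?w p else 0) = (\<Sum>p\<in>?S. if (p \<circ> r) 0 = 0 then ?w (p \<circ> r) else 0)"
      by (rule sum_permutations_compose_right[OF r(1)])
    also have "\<dots> = (\<Sum>p\<in>?S. if p q = 0 then ?w p else 0)"
      using r by (intro sum.cong) auto
    finally show ?thesis by simp
  qed
  have one: "(\<Sum>q<?N. if p q = 0 then ?w p else 0) = ?w p" if "p \<in> ?S" for p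
  proof -
    from that have p: "p permutes {..<?N}" by simp
    have "(\<Sum>q<?N. if p q = 0 then ?w p else 0) = (\<Sum>q<?N. if q = 0 then ?w p else 0)"
      using sum.permute[OF p, of "\<lambda>q. if q = 0 then ?w p else 0"] by (simp add: o_def)
    then show ?thesis by simp
  qed
  have "(\<Sum>p\<in>?S. ?w p) = (\<Sum>p\<in>?S. \<Sum>q<?N. if p q = 0 then ?w p else 0)"
    using one by (intro sum.cong) auto
  also have "\<dots> = (\<Sum>q<?N. \<Sum>p\<in>?S. if p q = 0 then ?w p else 0)"
    by (rule sum.swap)
  also have "\<dots> = (\<Sum>q<?N. \<Sum>p\<in>?S. if p 0 = 0 then ?w p else 0)"
    by (rule sum.cong[OF refl], rule const) simp
  finally show ?thesis by simp
qed

text \<open>After normalising to \<open>p 0 = 0\<close>, the sum is split by \<open>j = p 1\<close>.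
  Composing with \<open>swap 1 j\<close> on the left reduces to permutations fixing 0 and 1. The
  minor carries index 1 in the place left by \<open>j\<close>, so the usual alternating sign becomes
  the sign of \<open>swap 1 j\<close>.\<close>

lemma pfaffian_expand:
  assumes skew: "\<And>a b. a < 2 * Suc m \<Longrightarrow> b < 2 * Suc m \<Longrightarrow> A a b = - A b a"
  shows "pfaffian (Suc m) A = (\<Sum>j = 1..<2 * Suc m. of_int (sign (swap 1 j)) * A 0 j *
           pfaffian m (\<lambda>a b. A (swap 1 j (a + 2)) (swap 1 j (b + 2))))"
proof -
  let ?N = "2 * Suc m" and ?S = "{p. p permutes {..<2 * Suc m}}"
  let ?w = "pf_weight (Suc m) A"
  let ?sh = "map_permutation {..<2 * m} (\<lambda>x::nat. x + 2)"
  have inj: "inj_on (\<lambda>x::nat. x + 2) {..<2 * m}" by (auto simp: inj_on_def)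
  have split: "(if p 0 = 0 then ?w p else 0) = (\<Sum>j=1..<?N. if p 0 = 0 \<and> p 1 = j then ?w p else 0)"
    if "p \<in> ?S" for p
  proof (cases "p 0 = 0")
    case True
    from that have p: "p permutes {..<?N}" by simp
    have "p 1 \<in> {1..<?N}"
      using permutes_in_image[OF p, of 1] inj_eq[OF permutes_inj[OF p], of 1 0] True by auto
    with True show ?thesis by simp
  qed simp
  have each: "(\<Sum>p\<in>?S. if p 0 = 0 \<and> p 1 = j then ?w p else 0) =
     of_int (sign (swap 1 j)) * A 0 j *
       (\<Sum>p | p permutes {..<2 * m}. pf_weight m (\<lambda>a b. A (swap 1 j (a + 2)) (swap 1 j (b + 2))) p)"
    if j: "j \<in> {1..<?N}" for j
  proof -
    let ?t = "swap 1 j"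
    have t: "?t permutes {..<?N}" using j by (intro permutes_swap_id) auto
    have t0: "swap (Suc 0) j 0 = 0" "swap (Suc 0) j (Suc 0) = j" using j by (auto simp: Transposition.transpose_def)
    have t1: "?t x = j \<longleftrightarrow> x = 1" "?t x = 0 \<longleftrightarrow> x = 0" for x
      using j by (auto simp: Transposition.transpose_def)
    \<comment> \<open>Substituting \<open>?t \<circ> p\<close> for \<open>p\<close> turns the
      condition \<open>p 1 = j\<close> into \<open>p 1 = 1\<close>.\<close>
    have "(\<Sum>p\<in>?S. if p 0 = 0 \<and> p 1 = j then ?w p else 0) = (\<Sum>p\<in>?S. if p 0 = 0 \<and> p 1 = 1 then ?w (?t \<circ> p) else 0)"
      unfolding setum_permutations_compose_left[OF t, of "\<lambda>p. if p 0 = 0 \<and> p 1 = j then ?w p else 0"]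
      using t1 by simp
    also have "\<dots> = (\<Sum>p | p \<in> ?S \<and> p 0 = 0 \<and> p 1 = 1. ?w (?t \<circ> p))"
      by (subst sum.inter_filter[symmetric]) (auto simp: finite_permutations)
    also have "{p. p \<in> ?S \<and> p 0 = 0 \<and> p 1 = 1} = {p. p permutes {2..<2 * m + 2}}"
    proof safe
      fix p :: "nat \<Rightarrow> nat" assume p: "p permutes {..<2 * Suc m}" "p 0 = 0" "p 1 = 1"
      show "p permutes {2..<2 * m + 2}"
        by (rule permutes_superset[OF p(1)]) (use p in \<open>auto simp: not_le less_2_cases_iff\<close>)
    next
      fix p assume p: "p permutes {2..<2 * m + 2}"
      show "p permutes {..<2 * Suc m}" by (rule permutes_subset[OF p]) auto
      show "p 0 = 0" "p 1 = 1" using permutes_not_in[OF p] by auto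
    qed
    also have "(\<Sum>p | p permutes {2..<2 * m + 2}. ?w (?t \<circ> p)) = (\<Sum>p | p permutes {..<2 * m}. ?w (?t \<circ> ?sh p))"
      by (rule sum_permutes_shift)
    also have "\<dots> = (\<Sum>p | p permutes {..<2 * m}. of_int (sign ?t) * A 0 j *
        pf_weight m (\<lambda>a b. A (?t (a + 2)) (?t (b + 2))) p)"
    proof (rule sum.cong)
      fix p assume "p \<in> {p. p permutes {..<2 * m}}"
      then have p: "p permutes {..<2 * m}" by simp
      have shp: "?sh p permutes {2..<2 * m + 2}" 
        by (rule map_permutation_permutes[OF _ p], rule bij_betwI[of _ _ _ "\<lambda>x. x - 2"]) auto
      have sg: "sign (?t \<circ> ?sh p) = sign ?t * sign p"
        using sign_map_permutation[OF inj p] shp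
        by (subst sign_compose) (auto simp: permutation_swap_id intro: permutes_imp_permutation)
      have sh0: "?sh p 0 = 0" "?sh p (Suc 0) = Suc 0" using permutes_not_in[OF shp] by auto
      have sh2: "?sh p (x + 2) = p x + 2" if "x < 2 * m" for x
        using map_permutation_apply[OF inj, of x p] that by simp
      have "(\<Prod>i<m. A (?t (?sh p (2 * Suc i))) (?t (?sh p (2 * Suc i + 1)))) =
         (\<Prod>i<m. A (?t (p (2 * i) + 2)) (?t (p (2 * i + 1) + 2)))"
      proof (rule prod.cong)
        fix i assume "i \<in> {..<m}"
        then show "A (?t (?sh p (2 * Suc i))) (?t (?sh p (2 * Suc i + 1))) = A (?t (p (2 * i) + 2)) (?t (p (2 * i + 1) + 2))"
          using sh2[of "2 * i"] sh2[of "2 * i + 1"] by (simp add: numeral_eq_Suc)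
      qed simp
      then show "?w (?t \<circ> ?sh p) = of_int (sign ?t) * A 0 j * pf_weight m (\<lambda>a b. A (?t (a + 2)) (?t (b + 2))) p"
        unfolding pf_weight_def sg prod.lessThan_Suc_shift by (simp add: sh0 t0 del: mult_Suc_right add_2_eq_Suc')
    qed simp
    finally show ?thesis by (simp add: sum_distrib_left)
  qed
  have "(\<Sum>p\<in>?S. ?w p) = real ?N * (\<Sum>p\<in>?S. if p 0 = 0 then ?w p else 0)"
    by (rule sum_weight_first_fixed) (rule skew)
  also have "(\<Sum>p\<in>?S. if p 0 = 0 then ?w p else 0) = (\<Sum>p\<in>?S. \<Sum>j=1..<?N. if p 0 = 0 \<and> p 1 = j then ?w p else 0)"
    using split by (intro sum.cong) auto
  also have "\<dots> = (\<Sum>j=1..<?N. \<Sum>p\<in>?S. if p 0 = 0 \<and> p 1 = j then ?w p else 0)"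
    by (rule sum.swap)
  also have "\<dots> = (\<Sum>j=1..<?N. of_int (sign (swap 1 j)) * A 0 j *
       (\<Sum>p | p permutes {..<2 * m}. pf_weight m (\<lambda>a b. A (swap 1 j (a + 2)) (swap 1 j (b + 2))) p))"
    using each by (intro sum.cong) auto
  finally have sum: "(\<Sum>p\<in>?S. ?w p) = real ?N * (\<Sum>j=1..<?N. of_int (sign (swap 1 j)) * A 0 j *
       (\<Sum>p | p permutes {..<2 * m}. pf_weight m (\<lambda>a b. A (swap 1 j (a + 2)) (swap 1 j (b + 2))) p))" .
  \<comment> \<open>The factor \<open>2 * Suc m\<close> is the quotient of the normalisations for
    \<open>Suc m\<close> and \<open>m\<close>.\<close>
  have scale: "real ?N * x / (2 ^ Suc m * fact (Suc m)) = x / (2 ^ m * fact m)" for x :: real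
    by (simp add: divide_simps)
  show ?thesis
    unfolding pfaffian_weight sum scale by (simp only: sum_divide_distrib[of _ "{1..<?N}"] times_divide_eq_right)
qed

section \<open>Pfaffians of index lists and the Pluecker relation\<close>

lemma pfaffian_cong:
  assumes "\<And>a b. a < 2 * n \<Longrightarrow> b < 2 * n \<Longrightarrow> A a b = B a b"
  shows "pfaffian n A = pfaffian n B"
proof -
  have "pf_weight n A p = pf_weight n B p" if p: "p permutes {..<2 * n}" for p
    unfolding pf_weight_def
    by (intro arg_cong2[of _ _ _ _ "(*)"] refl prod.cong assms) (use permutes_in_image[OF p] in auto)
  then show ?thesis by (simp add: pfaffian_weight)
qed

lemma pfaffian_permute:
  assumes q: "q permutes {..<2 * n}"
  shows "pfaffian n (\<lambda>a b. A (q a) (q b)) = of_int (sign q) * pfaffian n A"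
proof -
  have "pf_weight n (\<lambda>a b. A (q a) (q b)) p = of_int (sign q) * pf_weight n A (q \<circ> p)"
    if p: "p permutes {..<2 * n}" for p
  proof -
    have "sign (q \<circ> p) = sign q * sign p"
      using p q by (simp add: sign_compose permutes_permutation)
    then have "sign p = sign q * sign (q \<circ> p)" by simp
    then show ?thesis unfolding pf_weight_def by simp
  qed
  then show ?thesis
    unfolding pfaffian_weight setum_permutations_compose_left[OF q, of "pf_weight n A"]
    by (simp add: sum_distrib_left)
qed

text \<open>Lists instead of index sets make reordering and repeated indices expressible. For odd
  length the \<open>div\<close> drops the last entry.\<close>

definition pf :: "('a \<Rightarrow> 'a \<Rightarrow> real) \<Rightarrow> 'a list \<Rightarrow> real" where
  "pf A xs = pfaffian (length xs div 2) (\<lambda>a b. A (xs ! a) (xs ! b))"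

lemma pf_swap:
  assumes "even (length xs)" "i < length xs" "j < length xs" "i \<noteq> j"
  shows "pf A (xs[i := xs ! j, j := xs ! i]) = - pf A xs"
proof -
  let ?n = "length xs div 2"
  have q: "swap i j permutes {..<2 * ?n}"
    using assms by (intro permutes_swap_id) auto
  have "pf A (xs[i := xs ! j, j := xs ! i]) =
      pfaffian ?n (\<lambda>a b. A (xs ! swap i j a) (xs ! swap i j b))"
    unfolding pf_def using assms
    by (auto intro!: pfaffian_cong simp: nth_list_update Transposition.transpose_def)
  also have "\<dots> = - pf A xs"
    using pfaffian_permute[OF q, of "\<lambda>a b. A (xs ! a) (xs ! b)"] assms
    by (simp add: pf_def sign_swap_id)
  finally show ?thesis .
qed

text \<open>Exchanging two equal entries leaves the list unchanged but flips the sign.\<close>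

lemma pf_not_distinct:
  assumes "even (length xs)" "\<not> distinct xs"
  shows "pf A xs = 0"
proof -
  from assms(2) obtain i j where ij: "i < length xs" "j < length xs" "i \<noteq> j" "xs ! i = xs ! j"
    by (auto simp: distinct_conv_nth)
  then have "xs[i := xs ! j, j := xs ! i] = xs" by (metis list_update_id)
  with pf_swap[OF assms(1) ij(1-3), of A] show ?thesis by simp
qed

lemma pf_swap_adjacent:
  assumes "even (length (xs @ x # y # ys))"
  shows "pf A (xs @ y # x # ys) = - pf A (xs @ x # y # ys)"
  using pf_swap[OF assms, of "length xs" "Suc (length xs)" A]
  by (simp add: nth_append list_update_append)

text \<open>The entry \<open>x\<close> passes the entries of \<open>ys\<close> one at a time, each
  adjacent swap costing a sign.\<close>

lemma pf_move:
  assumes "even (length (xs @ x # ys @ zs))"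
  shows "pf A (xs @ ys @ x # zs) = (- 1) ^ length ys * pf A (xs @ x # ys @ zs)"
  using assms
proof (induction ys arbitrary: xs)
  case (Cons y ys)
  from Cons.IH[of "xs @ [y]"] pf_swap_adjacent[of xs x y "ys @ zs" A] Cons.prems
  show ?case by simp
qed simp

text \<open>The signed Pfaffian of \<open>xs\<close> without its \<open>i\<close>-th entry. Putting the first entry in the vacant
  place, instead of closing the gap, makes the sign independent of the position \<open>i > 0\<close>.\<close>

definition pf_del :: "('a \<Rightarrow> 'a \<Rightarrow> real) \<Rightarrow> 'a list \<Rightarrow> nat \<Rightarrow> real" where
  "pf_del A xs i = (if i = 0 then pf A (tl xs) else - pf A ((tl xs)[i - 1 := hd xs]))"

text \<open>This is \<open>pfaffian_expand\<close> for lists: the sign of \<open>swap 1 j\<close> is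
  absorbed by \<open>pf_del\<close>, and position \<open>j\<close> of \<open>x # ys\<close> is
  position \<open>j - 1\<close> of \<open>ys\<close>.\<close>

lemma pf_Cons:
  assumes skew: "\<And>x y. A x y = - A y x" and odd: "odd (length ys)"
  shows "pf A (x # ys) = (\<Sum>i<length ys. A x (ys ! i) * pf_del A ys i)"
proof -
  from odd obtain m where m: "length ys = 2 * m + 1" by (rule oddE)
  then obtain a K where ys: "ys = a # K" and K: "length K = 2 * m" by (cases ys) auto
  let ?xs = "x # ys"
  have del: "pfaffian m (\<lambda>u v. A (?xs ! swap 1 j (u + 2)) (?xs ! swap 1 j (v + 2))) =
      of_int (sign (swap 1 j)) * pf_del A ys (j - 1)" if j: "j \<in> {1..<2 * Suc m}" for j
  proof (cases "j = 1")
    case True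
    then show ?thesis using K by (simp add: pf_del_def pf_def ys)
  next
    case False
    with j obtain k where k: "j = k + 2" "k < 2 * m"
      by (intro that[of "j - 2"]) auto
    have "pfaffian m (\<lambda>u v. A (?xs ! swap 1 j (u + 2)) (?xs ! swap 1 j (v + 2))) = pf A (K[k := a])"
      unfolding pf_def using K k
      by (auto intro!: pfaffian_cong simp: nth_list_update Transposition.transpose_def ys)
    then show ?thesis using k by (simp add: pf_del_def ys sign_swap_id)
  qed
  have "pf A ?xs = pfaffian (Suc m) (\<lambda>a b. A (?xs ! a) (?xs ! b))"
    by (simp add: pf_def m)
  also have "\<dots> = (\<Sum>j = 1..<2 * Suc m. of_int (sign (swap 1 j)) * A (?xs ! 0) (?xs ! j) *
      pfaffian m (\<lambda>u v. A (?xs ! swap 1 j (u + 2)) (?xs ! swap 1 j (v + 2))))"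
    by (rule pfaffian_expand) (rule skew)
  also have "\<dots> = (\<Sum>j = 1..<2 * Suc m. A (?xs ! 0) (?xs ! j) * pf_del A ys (j - 1))"
    by (intro sum.cong refl, subst del) (auto simp: sign_def)
  also have "\<dots> = (\<Sum>i<length ys. A x (ys ! i) * pf_del A ys i)"
    unfolding m by (rule sum.reindex_bij_witness[of _ Suc "\<lambda>j. j - 1"]) (auto simp: nth_Cons')
  finally show ?thesis .
qed

text \<open>Both sides equal \<open>\<Sum>i. \<Sum>j. A (a ! i) (b ! j) * pf_del A a i * pf_del A b j\<close>, up to the
  sign coming from the skew symmetry of \<open>A\<close>.\<close>

lemma pf_exchange:
  assumes skew: "\<And>x y. A x y = - A y x" and odd: "odd (length a)" "odd (length b)"
  shows "(\<Sum>i<length a. pf_del A a i * pf A (a ! i # b)) =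
    - (\<Sum>j<length b. pf_del A b j * pf A (b ! j # a))"
proof -
  have "(\<Sum>i<length a. pf_del A a i * pf A (a ! i # b)) =
      (\<Sum>i<length a. \<Sum>j<length b. pf_del A a i * (A (a ! i) (b ! j) * pf_del A b j))"
    using odd by (simp add: pf_Cons[of A, OF skew] sum_distrib_left)
  also have "\<dots> = (\<Sum>j<length b. \<Sum>i<length a. pf_del A a i * (A (a ! i) (b ! j) * pf_del A b j))"
    by (rule sum.swap)
  also have "\<dots> = (\<Sum>j<length b. \<Sum>i<length a. - (pf_del A b j * (A (b ! j) (a ! i) * pf_del A a i)))"
    by (intro sum.cong refl, subst skew) simp
  also have "\<dots> = - (\<Sum>j<length b. pf_del A b j * pf A (b ! j # a))"
    using odd by (simp add: pf_Cons[of A, OF skew] sum_distrib_left sum_negf)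
  finally show ?thesis .
qed

text \<open>Apply \<open>pf_exchange\<close> to \<open>a # K\<close> and
  \<open>b # c # d # K\<close>. Every term that inserts an entry of \<open>K\<close> has a repeated
  index and vanishes, which leaves one product on the left and three on the right.\<close>

lemma pf_pluecker:
  assumes skew: "\<And>x y. A x y = - A y x" and even: "even (length K)"
  shows "pf A K * pf A (a # b # c # d # K) =
    pf A (a # b # K) * pf A (c # d # K) - pf A (a # c # K) * pf A (b # d # K)
      + pf A (a # d # K) * pf A (b # c # K)"
proof -
  let ?b = "b # c # d # K"
  have "(\<Sum>i<length (a # K). pf_del A (a # K) i * pf A ((a # K) ! i # ?b)) =
      pf A K * pf A (a # ?b) + (\<Sum>i<length K. pf_del A (a # K) (Suc i) * pf A (K ! i # ?b))"
    by (simp add: sum.lessThan_Suc_shift pf_del_def del: sum.lessThan_Suc)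
  also have "(\<Sum>i<length K. pf_del A (a # K) (Suc i) * pf A (K ! i # ?b)) = 0"
    by (intro sum.neutral ballI) (use even in \<open>simp add: pf_not_distinct\<close>)
  finally have l: "(\<Sum>i<length (a # K). pf_del A (a # K) i * pf A ((a # K) ! i # ?b)) = pf A K * pf A (a # ?b)"
    by simp
  \<comment> \<open>Deleting \<open>c\<close> or \<open>d\<close> puts \<open>b\<close> in the
    vacant place; this gives the two minus signs and the order \<open>c # b # K\<close>.\<close>
  have "(\<Sum>j<length ?b. pf_del A ?b j * pf A (?b ! j # a # K)) =
     pf A (c # d # K) * pf A (b # a # K) - pf A (b # d # K) * pf A (c # a # K)
      - pf A (c # b # K) * pf A (d # a # K)
      + (\<Sum>i<length K. pf_del A ?b (Suc (Suc (Suc i))) * pf A (K ! i # a # K))"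
    by (simp add: sum.lessThan_Suc_shift pf_del_def del: sum.lessThan_Suc)
  also have "(\<Sum>i<length K. pf_del A ?b (Suc (Suc (Suc i))) * pf A (K ! i # a # K)) = 0"
    by (intro sum.neutral ballI) (use even in \<open>simp add: pf_not_distinct\<close>)
  finally have r: "(\<Sum>j<length ?b. pf_del A ?b j * pf A (?b ! j # a # K)) =
     pf A (c # d # K) * pf A (b # a # K) - pf A (b # d # K) * pf A (c # a # K)
      - pf A (c # b # K) * pf A (d # a # K)" by simp
  have s: "pf A (y # x # K) = - pf A (x # y # K)" for x y
    using pf_swap_adjacent[of "[]" x y K A] even by simp
  from pf_exchange[of A "a # K" ?b, OF skew] even
  have "pf A K * pf A (a # ?b) = - (pf A (c # d # K) * pf A (b # a # K) - pf A (b # d # K) * pf A (c # a # K)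
      - pf A (c # b # K) * pf A (d # a # K))"
    unfolding l r by simp
  then show ?thesis
    unfolding s[of b a] s[of c a] s[of c b] s[of d a] by (simp add: algebra_simps)
qed

section \<open>Schur polynomials at power sums\<close>

unbundle no vec_syntax
unbundle fps_syntax


lemma poly_mapping_sum_single:
  "(p :: 'a \<Rightarrow>\<^sub>0 'b::comm_monoid_add) = (\<Sum>m\<in>Poly_Mapping.keys p. Poly_Mapping.single m (Poly_Mapping.lookup p m))"
proof (rule poly_mapping_eqI)
  fix k
  have "Poly_Mapping.lookup (\<Sum>m\<in>Poly_Mapping.keys p. Poly_Mapping.single m (Poly_Mapping.lookup p m)) k =
      (\<Sum>m\<in>Poly_Mapping.keys p. if k = m then Poly_Mapping.lookup p m else 0)"
    by (simp add: lookup_sum lookup_single when_def eq_commute)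
  then show "Poly_Mapping.lookup p k =
      Poly_Mapping.lookup (\<Sum>m\<in>Poly_Mapping.keys p. Poly_Mapping.single m (Poly_Mapping.lookup p m)) k"
    by (simp add: in_keys_iff)
qed

section \<open>Maps on polynomials determined by their values on monomials\<close>

definition poly_sum :: "('m \<Rightarrow> 'c \<Rightarrow> 'b::comm_monoid_add) \<Rightarrow> ('m \<Rightarrow>\<^sub>0 'c::comm_monoid_add) \<Rightarrow> 'b" where
  "poly_sum h p = (\<Sum>m\<in>Poly_Mapping.keys p. h m (Poly_Mapping.lookup p m))"

text \<open>Because \<open>h m 0 = 0\<close>, monomials outside the support contribute nothing, so
  \<open>poly_sum\<close> is additive even when coefficients cancel and the support of a sum
  shrinks.\<close>

locale additive_on_monomials =
  fixes h :: "'m::comm_monoid_add \<Rightarrow> 'c::comm_semiring_1 \<Rightarrow> 'b::comm_monoid_add"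
  assumes h_0: "h m 0 = 0" and h_add: "h m (a + b) = h m a + h m b"
begin

lemma poly_sum_0 [simp]: "poly_sum h 0 = 0"
  by (simp add: poly_sum_def)

lemma poly_sum_add: "poly_sum h (p + q) = poly_sum h p + poly_sum h q"
  unfolding poly_sum_def by (rule setsum_keys_plus_distrib) (simp_all add: h_0 h_add)

lemma poly_sum_sum: "poly_sum h (sum f S) = (\<Sum>x\<in>S. poly_sum h (f x))"
  by (induction S rule: infinite_finite_induct) (simp_all add: poly_sum_add)

lemma poly_sum_single: "poly_sum h (Poly_Mapping.single m c) = h m c"
  by (cases "c = 0") (simp_all add: poly_sum_def h_0)

lemma poly_sum_single_mult:
  "poly_sum h (Poly_Mapping.single a c * q) =
     (\<Sum>m\<in>Poly_Mapping.keys q. h (a + m) (c * Poly_Mapping.lookup q m))"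
  by (subst poly_mapping_sum_single[of q])
     (simp add: sum_distrib_left mult_single poly_sum_sum poly_sum_single)

end

text \<open>The linear functional that extends \<open>G\<close> from monomials to polynomials. It
  serves with \<open>G m\<close> a Pfaffian whose indices are raised by the exponents of
  \<open>m\<close>.\<close>

definition lin :: "((nat \<Rightarrow>\<^sub>0 nat) \<Rightarrow> real) \<Rightarrow> time_poly \<Rightarrow> real" where
  "lin G = poly_sum (\<lambda>m c. c * G m)"

interpretation lin: additive_on_monomials "\<lambda>m c. c * (G m :: real)" for G
  by unfold_locales (simp_all add: algebra_simps)

lemma lin_0 [simp]: "lin G 0 = 0"
  by (simp add: lin_def)

lemma lin_sum: "lin G (sum f S) = (\<Sum>x\<in>S. lin G (f x))"
  by (simp add: lin_def lin.poly_sum_sum)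

lemma lin_single: "lin G (Poly_Mapping.single m c) = c * G m"
  by (simp add: lin_def lin.poly_sum_single)

lemma lin_single_mult:
  "lin G (Poly_Mapping.single a c * q) = c * lin (\<lambda>m. G (a + m)) q"
  unfolding lin_def lin.poly_sum_single_mult by (simp add: poly_sum_def sum_distrib_left mult_ac)

lemma lin_const_mult: "lin G (poly_const c * q) = c * lin G q"
  by (simp add: poly_const_def lin_single_mult)

lemma lin_cong: "(\<And>m. G m = H m) \<Longrightarrow> lin G q = lin H q"
  by presburger

lemma lin_sum_left: "lin (\<lambda>m. \<Sum>j\<in>S. G j m) q = (\<Sum>j\<in>S. lin (G j) q)"
  unfolding lin_def poly_sum_def by (simp add: sum_distrib_left) (rule sum.swap)

lemma poly_const_mult: "poly_const a * poly_const b = poly_const (a * b)"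
  by (simp add: poly_const_def mult_single)

lemma poly_const_0 [simp]: "poly_const 0 = 0" by (simp add: poly_const_def)
lemma poly_const_1 [simp]: "poly_const 1 = 1" by (simp add: poly_const_def)

lemma poly_const_of_nat: "poly_const (of_nat n) = of_nat n"
  by (simp add: poly_const_def)

definition mono_eval :: "(nat \<Rightarrow> time_poly) \<Rightarrow> (nat \<Rightarrow>\<^sub>0 nat) \<Rightarrow> time_poly" where
  "mono_eval y m = (\<Prod>l\<in>Poly_Mapping.keys m. y l ^ Poly_Mapping.lookup m l)"

lemma mono_eval_superset:
  assumes "finite S" "Poly_Mapping.keys m \<subseteq> S"
  shows "mono_eval y m = (\<Prod>l\<in>S. y l ^ Poly_Mapping.lookup m l)"
  unfolding mono_eval_def using assms
  by (intro prod.mono_neutral_left) (auto simp: in_keys_iff)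

lemma mono_eval_0 [simp]: "mono_eval y 0 = 1"
  by (simp add: mono_eval_def)

lemma mono_eval_add: "mono_eval y (a + b) = mono_eval y a * mono_eval y b"
  using keys_add[of a b]
  by (simp add: mono_eval_superset[of "Poly_Mapping.keys a \<union> Poly_Mapping.keys b"] lookup_add
      power_add prod.distrib)

lemma mono_eval_single [simp]: "mono_eval y (Poly_Mapping.single l (Suc 0)) = y l"
  by (simp add: mono_eval_def)

text \<open>Substitution of \<open>y l\<close> for the variable of index \<open>l\<close>. The
  values are again in \<open>time_poly\<close>, since power sums in new variables are to be
  substituted.\<close>

definition poly_eval :: "(nat \<Rightarrow> time_poly) \<Rightarrow> time_poly \<Rightarrow> time_poly" where
  "poly_eval y = poly_sum (\<lambda>m c. poly_const c * mono_eval y m)"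

interpretation poly_eval: additive_on_monomials "\<lambda>m c. poly_const c * mono_eval y m" for y
  by unfold_locales (simp_all add: poly_const_def single_add algebra_simps)

lemma poly_eval_1 [simp]: "poly_eval y 1 = 1"
  using poly_eval.poly_sum_single[of y 0 1] by (simp add: poly_eval_def)

lemma poly_eval_sum: "poly_eval y (sum f S) = (\<Sum>x\<in>S. poly_eval y (f x))"
  by (simp add: poly_eval_def poly_eval.poly_sum_sum)

lemma poly_eval_single_mult:
  "poly_eval y (Poly_Mapping.single a c * q) = poly_const c * mono_eval y a * poly_eval y q"
  unfolding poly_eval_def poly_eval.poly_sum_single_mult
  by (simp add: poly_sum_def sum_distrib_left mono_eval_add mult_ac flip: poly_const_mult)

lemma poly_eval_var_mult: "poly_eval y (poly_var l * q) = y l * poly_eval y q"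
  by (simp add: poly_var_def poly_eval_single_mult)

lemma poly_eval_of_nat_mult: "poly_eval y (of_nat n * q) = of_nat n * poly_eval y q"
  using poly_eval_single_mult[of y 0 "of_nat n" q] by (simp add: poly_const_of_nat)

section \<open>The Schur generating series and elementary symmetric polynomials\<close>

lemma schur_gf_deriv:
  "fps_deriv schur_gf = schur_gf * Abs_fps (\<lambda>k. of_nat (Suc k) * poly_var (Suc k))"
proof -
  let ?E = "Abs_fps (\<lambda>m. poly_const (1 / fact m))"
  let ?T = "Abs_fps (\<lambda>l. if l = 0 then 0 else poly_var l)"
  have E: "fps_deriv ?E = ?E"
  proof (rule fps_ext)
    fix n
    have "of_nat (Suc n) * poly_const (1 / fact (Suc n)) = poly_const (of_nat (Suc n) * (1 / fact (Suc n)))"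
      by (simp only: poly_const_of_nat[symmetric] poly_const_mult)
    also have "of_nat (Suc n) * (1 / fact (Suc n)) = (1 / fact n :: real)"
      by (simp only: fact_Suc of_nat_mult times_divide_eq_right mult_1_right) (simp del: of_nat_Suc)
    finally show "fps_deriv ?E $ n = ?E $ n" by simp
  qed
  \<comment> \<open>Chain rule, with the exponential series being its own derivative.\<close>
  have "fps_deriv schur_gf = schur_gf * fps_deriv ?T"
    unfolding schur_gf_def by (subst fps_compose_deriv) (simp_all add: E)
  also have "fps_deriv ?T = Abs_fps (\<lambda>k. of_nat (Suc k) * poly_var (Suc k))"
    by (rule fps_ext) simp
  finally show ?thesis .
qed

lemma schur_gf_0: "schur_gf $ 0 = 1"
  by (simp add: schur_gf_def)

text \<open>Coefficient \<open>k\<close> of the equation determines \<open>Suc k\<close> times the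
  next coefficient from the earlier ones, and \<open>Suc k\<close> cancels in an integral domain of
  characteristic zero.\<close>

lemma fps_linear_ode_unique:
  fixes F G P :: "'a::{idom, ring_char_0} fps"
  assumes F: "fps_deriv F = F * P" and G: "fps_deriv G = G * P" and 0: "F $ 0 = G $ 0"
  shows "F = G"
proof (rule fps_ext)
  fix n
  show "F $ n = G $ n"
  proof (induction n rule: less_induct)
    case (less n)
    show ?case
    proof (cases n)
      case (Suc k)
      have "of_nat (Suc k) * F $ Suc k = (F * P) $ k" by (simp flip: F)
      also have "\<dots> = (G * P) $ k"
        unfolding fps_mult_nth by (intro sum.cong) (auto simp: less Suc)
      also have "\<dots> = of_nat (Suc k) * G $ Suc k" by (simp flip: G)
      finally show ?thesis unfolding Suc mult_cancel_left by (simp del: of_nat_Suc)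
    qed (simp add: 0)
  qed
qed

text \<open>Logarithmic derivatives: \<open>- x / (1 - x X) = - (\<Sum>k. x ^ (k + 1) * X ^ k)\<close>.\<close>

lemma deriv_prod_one_minus:
  fixes x :: "'i \<Rightarrow> 'a::comm_ring_1"
  assumes "finite S"
  defines "Q \<equiv> \<lambda>S. \<Prod>j\<in>S. 1 - fps_const (x j) * fps_X"
  shows "fps_deriv (Q S) = Q S * Abs_fps (\<lambda>k. - (\<Sum>j\<in>S. x j ^ Suc k))"
  using assms(1)
proof (induction S rule: finite_induct)
  case empty
  show ?case unfolding Q_def by (simp add: fps_eq_iff)
next
  case (insert i S)
  let ?L = "1 - fps_const (x i) * fps_X"
  have geo: "?L * Abs_fps (\<lambda>k. x i ^ Suc k) = fps_const (x i)"
  proof (rule fps_ext)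
    fix n show "(?L * Abs_fps (\<lambda>k. x i ^ Suc k)) $ n = fps_const (x i) $ n"
      by (cases n) (simp_all add: left_diff_distrib mult.assoc)
  qed
  have L: "fps_deriv ?L = - fps_const (x i)" by simp
  have "fps_deriv (Q (insert i S)) = ?L * fps_deriv (Q S) - fps_const (x i) * Q S"
    unfolding Q_def prod.insert[OF insert(1,2)] fps_deriv_mult L
    by (simp only: mult_minus_left add_uminus_conv_diff)
  also have "\<dots> = ?L * fps_deriv (Q S) - ?L * Abs_fps (\<lambda>k. x i ^ Suc k) * Q S"
    by (simp only: geo)
  also have "\<dots> = ?L * Q S * (Abs_fps (\<lambda>k. - (\<Sum>j\<in>S. x j ^ Suc k)) - Abs_fps (\<lambda>k. x i ^ Suc k))"
    unfolding insert.IH by (simp only: algebra_simps)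
  also have "?L * Q S = Q (insert i S)"
    unfolding Q_def by (rule prod.insert[OF insert(1,2), symmetric])
  also have "Abs_fps (\<lambda>k. - (\<Sum>j\<in>S. x j ^ Suc k)) - Abs_fps (\<lambda>k. x i ^ Suc k) =
      Abs_fps (\<lambda>k. - (\<Sum>j\<in>insert i S. x j ^ Suc k))"
    using insert(1,2) by (simp add: fps_eq_iff)
  finally show ?case .
qed

text \<open>Expanding the product over the subsets \<open>I\<close> of \<open>S\<close>, the subset
  \<open>I\<close> contributes only in degree \<open>card I\<close>.\<close>

lemma prod_one_minus_nth:
  fixes x :: "'i \<Rightarrow> 'a::comm_ring_1"
  assumes "finite S"
  shows "(\<Prod>j\<in>S. 1 - fps_const (x j) * fps_X) $ k = (- 1) ^ k * (\<Sum>I | I \<subseteq> S \<and> card I = k. \<Prod>j\<in>I. x j)"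
proof -
  have pc: "(\<Prod>j\<in>I. fps_const (- x j) * fps_X) = fps_const ((- 1) ^ card I * (\<Prod>j\<in>I. x j)) * fps_X ^ card I"
    if "finite I" for I
    using that by (induction I rule: finite_induct) (simp_all add: mult_ac flip: fps_const_mult fps_const_neg)
  have "(\<Prod>j\<in>S. 1 - fps_const (x j) * fps_X) = (\<Prod>j\<in>S. fps_const (- x j) * fps_X + 1)"
    by (simp flip: fps_const_neg)
  also have "\<dots> = (\<Sum>I\<in>Pow S. \<Prod>j\<in>I. fps_const (- x j) * fps_X)"
    by (subst prod_add[OF assms]) simp
  also have "\<dots> = (\<Sum>I\<in>Pow S. fps_const ((- 1) ^ card I * (\<Prod>j\<in>I. x j)) * fps_X ^ card I)"
    using assms by (intro sum.cong refl pc) (auto intro: finite_subset)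
  also have "\<dots> $ k = (\<Sum>I\<in>Pow S. if card I = k then (- 1) ^ k * (\<Prod>j\<in>I. x j) else 0)"
    unfolding fps_sum_nth by (intro sum.cong) (auto simp: fps_X_power_iff)
  also have "\<dots> = (\<Sum>I | I \<in> Pow S \<and> card I = k. (- 1) ^ k * (\<Prod>j\<in>I. x j))"
    using assms by (intro sum.inter_filter[symmetric]) auto
  finally show ?thesis by (simp add: sum_distrib_left)
qed

text \<open>The variables now stand for \<open>x_0, x_1, ...\<close>, which raise the indices of a
  Pfaffian, and no longer for times; so index 0 is a genuine variable here.\<close>

definition power_sum :: "nat \<Rightarrow> nat \<Rightarrow> time_poly" where
  "power_sum N l = (\<Sum>j<N. Poly_Mapping.single (Poly_Mapping.single j l) 1)"

lemma poly_var_power: "poly_var j ^ l = Poly_Mapping.single (Poly_Mapping.single j l) 1"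
  by (induction l) (simp_all add: poly_var_def mult_single flip: single_add)

lemma prod_poly_var:
  "finite I \<Longrightarrow> (\<Prod>j\<in>I. poly_var j) = Poly_Mapping.single (\<Sum>j\<in>I. Poly_Mapping.single j 1) 1"
  by (induction I rule: finite_induct) (simp_all add: poly_var_def mult_single)

text \<open>Evaluating the generating series coefficientwise gives a series \<open>F\<close> with
  logarithmic derivative \<open>?P\<close>. The product of the factors \<open>1 - x_j z\<close>
  satisfies the same equation with the same constant term, so the two agree.\<close>

lemma schur_eval_power_sum:
  "poly_eval (\<lambda>l. poly_const (- (1 / real l)) * power_sum N l) (schur_poly (int k)) =
     (- 1) ^ k * (\<Sum>I | I \<subseteq> {..<N} \<and> card I = k. Poly_Mapping.single (\<Sum>j\<in>I. Poly_Mapping.single j 1) 1)"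
proof -
  let ?y = "\<lambda>l. poly_const (- (1 / real l)) * power_sum N l"
  let ?P = "Abs_fps (\<lambda>k. - power_sum N (Suc k))"
  define F where "F = Abs_fps (\<lambda>k. poly_eval ?y (schur_gf $ k))"
  \<comment> \<open>The factor \<open>Suc k\<close> produced by differentiation cancels the
    \<open>1 / l\<close> of the substitution at \<open>l = Suc k\<close>.\<close>
  have y: "of_nat (Suc k) * ?y (Suc k) = - power_sum N (Suc k)" for k
  proof -
    have "of_nat (Suc k) * ?y (Suc k) = poly_const (of_nat (Suc k) * (- (1 / real (Suc k)))) * power_sum N (Suc k)"
      by (simp only: poly_const_of_nat[symmetric] poly_const_mult mult.assoc[symmetric])
    also have "of_nat (Suc k) * (- (1 / real (Suc k))) = - 1" by simp
    finally show ?thesis by (simp add: poly_const_def single_uminus)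
  qed
  have "fps_deriv F = F * ?P"
  proof (rule fps_ext)
    fix k
    have "fps_deriv F $ k = poly_eval ?y (fps_deriv schur_gf $ k)"
      using poly_eval_of_nat_mult[of ?y "Suc k"] by (simp add: F_def del: of_nat_Suc)
    also have "\<dots> = (\<Sum>i = 0..k. poly_eval ?y (of_nat (Suc (k - i)) * (poly_var (Suc (k - i)) * schur_gf $ i)))"
      unfolding schur_gf_deriv fps_mult_nth poly_eval_sum by (simp add: mult_ac del: of_nat_Suc)
    also have "\<dots> = (\<Sum>i = 0..k. (of_nat (Suc (k - i)) * ?y (Suc (k - i))) * poly_eval ?y (schur_gf $ i))"
      by (simp only: poly_eval_of_nat_mult poly_eval_var_mult mult.assoc)
    also have "\<dots> = (F * ?P) $ k"
      unfolding y fps_mult_nth by (simp add: F_def mult_ac)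
    finally show "fps_deriv F $ k = (F * ?P) $ k" .
  qed
  moreover have "fps_deriv (\<Prod>j<N. 1 - fps_const (poly_var j) * fps_X) = (\<Prod>j<N. 1 - fps_const (poly_var j) * fps_X) * ?P"
    using deriv_prod_one_minus[of "{..<N}" poly_var] by (simp add: poly_var_power power_sum_def del: power_Suc)
  moreover have "(\<Prod>j<n. 1 - fps_const (poly_var j) * fps_X) $ 0 = 1" for n
    by (induction n) simp_all
  then have "F $ 0 = (\<Prod>j<N. 1 - fps_const (poly_var j) * fps_X) $ 0"
by (simp add: F_def schur_gf_0)
  ultimately have "F = (\<Prod>j<N. 1 - fps_const (poly_var j) * fps_X)"
    by (rule fps_linear_ode_unique)
  then have "F $ k = (- 1) ^ k * (\<Sum>I | I \<subseteq> {..<N} \<and> card I = k. \<Prod>j\<in>I. poly_var j)"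
    by (simp add: prod_one_minus_nth)
  also have "(\<Sum>I | I \<subseteq> {..<N} \<and> card I = k. \<Prod>j\<in>I. poly_var j) =
     (\<Sum>I | I \<subseteq> {..<N} \<and> card I = k. Poly_Mapping.single (\<Sum>j\<in>I. Poly_Mapping.single j 1) 1)"
    by (intro sum.cong refl prod_poly_var) (auto intro: finite_subset)
  finally show ?thesis by (simp add: F_def schur_poly_def)
qed

section \<open>Time derivatives of Pfaffians\<close>

lemma sum_lessThan_double: "(\<Sum>k<2 * n. g k) = (\<Sum>i<n. g (2 * i) + g (2 * i + 1))" for n :: nat
  by (induction n) (simp_all add: add.assoc)

text \<open>By the product rule, differentiating one factor raises one of its two indices by
  \<open>l\<close>. In the product of a permutation every list position occurs exactly once, so the
  terms regroup by the position raised.\<close>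

lemma pf_has_derivative:
  fixes B :: "nat \<Rightarrow> nat \<Rightarrow> real \<Rightarrow> real" and l :: nat
  assumes B: "\<And>a b. (B a b has_real_derivative B (a + l) b x + B a (b + l) x) (at x)"
    and "even (length L)"
  shows "((\<lambda>y. pf (\<lambda>a b. B a b y) L) has_real_derivative
     (\<Sum>j<length L. pf (\<lambda>a b. B a b x) (L[j := L ! j + l]))) (at x)"
proof -
  define n where "n = length L div 2"
  have n: "length L = 2 * n" using assms(2) by (simp add: n_def)
  define M where "M j = L[j := L ! j + l]" for j
  define D where "D p i = B (L ! p (2 * i) + l) (L ! p (2 * i + 1)) x + B (L ! p (2 * i)) (L ! p (2 * i + 1) + l) x"
    for p :: "nat \<Rightarrow> nat" and i
  define W where "W p i = B (L ! p (2 * i)) (L ! p (2 * i + 1))" for p :: "nat \<Rightarrow> nat" and i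
  have main: "(\<Sum>i<n. D p i * (\<Prod>i'\<in>{..<n} - {i}. W p i' x)) =
      (\<Sum>j<2 * n. \<Prod>i<n. B (M j ! p (2 * i)) (M j ! p (2 * i + 1)) x)"
    if p: "p permutes {..<2 * n}" for p
  proof -
    have inj: "p a = p b \<longleftrightarrow> a = b" for a b using permutes_inj[OF p] by (simp add: inj_eq)
    have M: "M (p k) ! p k' = L ! p k' + (if k' = k then l else 0)" if "k' < 2 * n" for k k'
      using that permutes_in_image[OF p, of k'] n by (auto simp: M_def nth_list_update inj)
    have even: "(\<Prod>i'<n. B (M (p (2 * i)) ! p (2 * i')) (M (p (2 * i)) ! p (2 * i' + 1)) x) =
        B (L ! p (2 * i) + l) (L ! p (2 * i + 1)) x * (\<Prod>i'\<in>{..<n} - {i}. W p i' x)"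
      if i: "i < n" for i
    proof -
      have "(\<Prod>i'\<in>{..<n} - {i}. B (M (p (2 * i)) ! p (2 * i')) (M (p (2 * i)) ! p (2 * i' + 1)) x) =
          (\<Prod>i'\<in>{..<n} - {i}. W p i' x)"
        using i by (intro prod.cong refl) (auto simp: M W_def simp del: One_nat_def)
      with i show ?thesis
        by (subst prod.remove[of _ i]) (auto simp: M)
    qed
    have odd: "(\<Prod>i'<n. B (M (p (2 * i + 1)) ! p (2 * i')) (M (p (2 * i + 1)) ! p (2 * i' + 1)) x) =
        B (L ! p (2 * i)) (L ! p (2 * i + 1) + l) x * (\<Prod>i'\<in>{..<n} - {i}. W p i' x)"
      if i: "i < n" for i
    proof -
      have ne: "2 * i' \<noteq> 2 * i + 1" for i' :: nat by presburger
      have "(\<Prod>i'\<in>{..<n} - {i}. B (M (p (2 * i + 1)) ! p (2 * i')) (M (p (2 * i + 1)) ! p (2 * i' + 1)) x) =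
          (\<Prod>i'\<in>{..<n} - {i}. W p i' x)"
        using i ne by (intro prod.cong refl) (auto simp: M W_def simp del: One_nat_def)
      with i ne show ?thesis
        by (subst prod.remove[of _ i]) (auto simp: M)
    qed
    \<comment> \<open>Write the position as \<open>j = p k\<close>: then \<open>k = 2 * i\<close>
      raises the first argument of factor \<open>i\<close>, and \<open>k = 2 * i + 1\<close> the
      second.\<close>
    have "(\<Sum>j<2 * n. \<Prod>i<n. B (M j ! p (2 * i)) (M j ! p (2 * i + 1)) x) =
        (\<Sum>k<2 * n. \<Prod>i<n. B (M (p k) ! p (2 * i)) (M (p k) ! p (2 * i + 1)) x)"
      by (subst sum.permute[OF p]) (simp add: o_def)
    also have "\<dots> = (\<Sum>i<n. D p i * (\<Prod>i'\<in>{..<n} - {i}. W p i' x))"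
      unfolding sum_lessThan_double
      by (intro sum.cong refl) (simp only: lessThan_iff even odd D_def distrib_right)
    finally show ?thesis by simp
  qed
  have "((\<lambda>y. pf (\<lambda>a b. B a b y) L) has_real_derivative
      (\<Sum>p | p permutes {..<2 * n}. of_int (sign p) *
        (\<Sum>i<n. D p i * (\<Prod>i'\<in>{..<n} - {i}. W p i' x))) / (2 ^ n * fact n)) (at x)"
    unfolding pf_def pfaffian_def n_def[symmetric]
  proof (intro DERIV_cdivide DERIV_sum DERIV_cmult)
    fix p :: "nat \<Rightarrow> nat"
    show "((\<lambda>y. \<Prod>i<n. B (L ! p (2 * i)) (L ! p (2 * i + 1)) y) has_real_derivative
        (\<Sum>i<n. D p i * (\<Prod>i'\<in>{..<n} - {i}. W p i' x))) (at x)"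
      unfolding W_def D_def by (intro has_field_derivative_prod B)
  qed
  also have "(\<Sum>p | p permutes {..<2 * n}. of_int (sign p) *
        (\<Sum>i<n. D p i * (\<Prod>i'\<in>{..<n} - {i}. W p i' x))) / (2 ^ n * fact n) =
     (\<Sum>p | p permutes {..<2 * n}. \<Sum>j<2 * n. of_int (sign p) *
        (\<Prod>i<n. B (M j ! p (2 * i)) (M j ! p (2 * i + 1)) x)) / (2 ^ n * fact n)"
    by (simp add: main sum_distrib_left)
  also have "\<dots> = (\<Sum>j<length L. pf (\<lambda>a b. B a b x) (M j))"
    by (subst sum.swap) (simp add: pf_def pfaffian_def M_def n sum_divide_distrib)
  finally show ?thesis by (simp add: M_def)
qed

text \<open>Changing only the time \<open>t l\<close> stays inside \<open>time_slice l t\<close>,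
  where \<open>T\<close> is relatively open, and the path is continuous in the product
  topology.\<close>

lemma times_domain_eventually:
  assumes "times_domain T" "t \<in> T" "l \<ge> 1"
  shows "\<forall>\<^sub>F x in nhds (t l). t(l := x) \<in> T"
proof -
  let ?f = "\<lambda>x. t(l := x)"
  have cont: "continuous_on UNIV ?f"
  proof (rule continuous_on_coordinatewise_then_product)
    show "continuous_on UNIV (\<lambda>x. ?f x i)" for i
      by (cases "i = l") simp_all
  qed
  have "openin (top_of_set (time_slice l t)) (T \<inter> time_slice l t)"
    using assms(1) by (simp add: times_domain_def)
  then obtain U where U: "open U" "T \<inter> time_slice l t = time_slice l t \<inter> U"
    by (auto simp: openin_open)
  have sl: "?f x \<in> time_slice l t" for x
    using assms(3) by (auto simp: time_slice_def)
  have "open (?f -` U)"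
    using cont U(1) by (simp add: continuous_on_open_vimage)
  moreover have "t l \<in> ?f -` U"
    using U(2) sl[of "t l"] assms(2) by auto
  ultimately have "\<forall>\<^sub>F x in nhds (t l). x \<in> ?f -` U"
    by (rule eventually_nhds_in_open)
  then show ?thesis
    by eventually_elim (use U(2) sl in blast)
qed

text \<open>The derivative depends only on values near \<open>t\<close> along the line, and these
  lie in \<open>T\<close>. So identities known only on \<open>T\<close> can be
  differentiated.\<close>

lemma time_deriv_cong:
  assumes "times_domain T" "t \<in> T" "l \<ge> 1" "\<And>s. s \<in> T \<Longrightarrow> f s = g s"
  shows "time_deriv l f t = time_deriv l g t"
  unfolding time_deriv_def
  by (rule deriv_cong_ev[OF eventually_mono[OF times_domain_eventually[OF assms(1-3)]]])
     (auto simp: assms(4))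

section \<open>The action of polynomials on Pfaffians of moments\<close>

locale moments =
  fixes \<mu> :: "nat \<Rightarrow> nat \<Rightarrow> times \<Rightarrow> real" and T :: "times set"
  assumes domain: "times_domain T"
    and moment_deriv: "\<And>l i j t. l \<ge> 1 \<Longrightarrow> t \<in> T \<Longrightarrow>
          ((\<lambda>x. \<mu> i j (t(l := x))) has_real_derivative \<mu> (i + l) j t + \<mu> i (j + l) t) (at (t l))"
begin

definition tpf :: "nat list \<Rightarrow> times \<Rightarrow> real" where
  "tpf L t = pf (\<lambda>i j. \<mu> i j t) L"

lemma tpf_has_derivative:
  assumes "l \<ge> 1" "t \<in> T" "even (length L)"
  shows "((\<lambda>x. tpf L (t(l := x))) has_real_derivative
    (\<Sum>j<length L. tpf (L[j := L ! j + l]) t)) (at (t l))"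
  using pf_has_derivative[of "\<lambda>a b x. \<mu> a b (t(l := x))" l "t l" L] moment_deriv[OF assms(1,2)] assms(3)
  by (simp add: tpf_def)

lemma time_deriv_tpf:
  "l \<ge> 1 \<Longrightarrow> t \<in> T \<Longrightarrow> even (length L) \<Longrightarrow>
    time_deriv l (tpf L) t = (\<Sum>j<length L. tpf (L[j := L ! j + l]) t)"
  unfolding time_deriv_def by (rule DERIV_imp_deriv) (rule tpf_has_derivative)

text \<open>The monomial \<open>m\<close> acts by raising the \<open>j\<close>-th index of the Pfaffian by the exponent of the
  \<open>j\<close>-th variable, so that the derivative in \<open>t\<^sub>l\<close> becomes multiplication by the \<open>l\<close>-th power sum.\<close>

definition raise :: "nat \<Rightarrow> (nat \<Rightarrow>\<^sub>0 nat) \<Rightarrow> nat list" where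
  "raise n m = map (\<lambda>a. a + Poly_Mapping.lookup m a) [0..<2 * n]"

definition act :: "nat \<Rightarrow> time_poly \<Rightarrow> times \<Rightarrow> real" where
  "act n q t = lin (\<lambda>m. tpf (raise n m) t) q"

lemma raise_update:
  "j < 2 * n \<Longrightarrow> (raise n m)[j := raise n m ! j + l] = raise n (Poly_Mapping.single j l + m)"
  by (rule nth_equalityI) (auto simp: raise_def nth_list_update lookup_add lookup_single)

lemma tau_act: "tau \<mu> (int n) = act n 1"
  using lin_single[of _ 0 1]
  by (auto simp: fun_eq_iff tau_def act_def tpf_def raise_def pf_def intro!: pfaffian_cong)

lemma time_deriv_act:
  assumes "l \<ge> 1" "t \<in> T"
  shows "time_deriv l (act n q) t = act n (power_sum (2 * n) l * q) t"
proof -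
  have "((\<lambda>x. act n q (t(l := x))) has_real_derivative
      lin (\<lambda>m. \<Sum>j<length (raise n m). tpf ((raise n m)[j := raise n m ! j + l]) t) q) (at (t l))"
    unfolding act_def lin_def poly_sum_def
    by (intro DERIV_sum DERIV_cmult tpf_has_derivative assms) (simp add: raise_def)
  then have "time_deriv l (act n q) t =
      lin (\<lambda>m. \<Sum>j<length (raise n m). tpf ((raise n m)[j := raise n m ! j + l]) t) q"
    unfolding time_deriv_def by (rule DERIV_imp_deriv)
  also have "\<dots> = lin (\<lambda>m. \<Sum>j<2 * n. tpf (raise n (Poly_Mapping.single j l + m)) t) q"
    by (intro lin_cong sum.cong) (auto simp: raise_update, simp_all add: raise_def)
  also have "\<dots> = act n (power_sum (2 * n) l * q) t"
    by (simp add: act_def power_sum_def sum_distrib_right lin_sum lin_single_mult lin_sum_left)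
  finally show ?thesis .
qed

abbreviation schur_arg :: "nat \<Rightarrow> (times \<Rightarrow> real) \<Rightarrow> times \<Rightarrow> real" where
  "schur_arg \<equiv> \<lambda>l g t. - (1 / real l) * time_deriv l g t"

text \<open>The polynomial by which the operator \<open>schur_arg l\<close> acts as multiplication
  on \<open>act n q\<close>.\<close>

abbreviation schur_val :: "nat \<Rightarrow> nat \<Rightarrow> time_poly" where
  "schur_val n \<equiv> \<lambda>l. poly_const (- (1 / real l)) * power_sum (2 * n) l"

text \<open>For \<open>l = 0\<close> both sides are \<open>0\<close>, since \<open>1 / 0 = 0\<close>.\<close>

lemma schur_arg_act:
  assumes "\<And>s. s \<in> T \<Longrightarrow> f s = act n q s" "t \<in> T"
  shows "schur_arg l f t = act n (schur_val n l * q) t"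
proof (cases "l = 0")
  case False
  then have "schur_arg l f t = - (1 / real l) * act n (power_sum (2 * n) l * q) t"
    using time_deriv_cong[OF domain assms(2) _ assms(1), of l] time_deriv_act[of l t n q] assms(2) by simp
  then show ?thesis by (simp only: act_def mult.assoc lin_const_mult)
qed (simp add: act_def)

text \<open>The induction runs over all \<open>t\<close> in \<open>T\<close> at once, since each
  further derivative needs the previous iterate on a neighbourhood.\<close>

lemma schur_arg_pow_act:
  assumes "\<And>s. s \<in> T \<Longrightarrow> f s = act n q s" "t \<in> T"
  shows "(schur_arg l ^^ k) f t = act n (schur_val n l ^ k * q) t"
  using assms(2)
proof (induction k arbitrary: t)
  case (Suc k)
  have "(schur_arg l ^^ Suc k) f t = schur_arg l ((schur_arg l ^^ k) f) t" by simp
  also have "\<dots> = act n (schur_val n l * (schur_val n l ^ k * q)) t"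
    by (rule schur_arg_act) (use Suc in auto)
  finally show ?case by (simp add: mult.assoc)
qed (simp add: assms(1))

lemma foldr_schur_arg_act:
  assumes "\<And>s. s \<in> T \<Longrightarrow> f s = act n q s" "t \<in> T"
  shows "foldr (\<lambda>l. schur_arg l ^^ e l) ls f t = act n (prod_list (map (\<lambda>l. schur_val n l ^ e l) ls) * q) t"
  using assms(2)
proof (induction ls arbitrary: t)
  case (Cons l ls)
  have "foldr (\<lambda>l. schur_arg l ^^ e l) (l # ls) f t =
      (schur_arg l ^^ e l) (foldr (\<lambda>l. schur_arg l ^^ e l) ls f) t" by simp
  also have "\<dots> = act n (schur_val n l ^ e l * (prod_list (map (\<lambda>l. schur_val n l ^ e l) ls) * q)) t"
    by (rule schur_arg_pow_act) (use Cons in auto)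
  finally show ?case by (simp add: mult.assoc)
qed (simp add: assms(1))

text \<open>The operators of each monomial are composed in increasing order of index; they act as
  multiplications by polynomials, so the ordered composition becomes the unordered product
  \<open>mono_eval\<close>.\<close>

lemma schur_op_act:
  assumes "t \<in> T"
  shows "schur_op k (act n q) t = act n (poly_eval (schur_val n) (schur_poly k) * q) t"
proof -
  have "foldr (\<lambda>l. schur_arg l ^^ Poly_Mapping.lookup m l)
      (sorted_list_of_set (Poly_Mapping.keys m)) (act n q) t = act n (mono_eval (schur_val n) m * q) t" for m
    using foldr_schur_arg_act[of "act n q" n q t "Poly_Mapping.lookup m" "sorted_list_of_set (Poly_Mapping.keys m)"] assms
    by (simp add: mono_eval_def flip: prod.distinct_set_conv_list)
  then show ?thesis
    unfolding schur_op_def poly_subst_op_def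
    by (simp add: act_def poly_eval_def poly_sum_def sum_distrib_right lin_sum lin_const_mult mult.assoc)
qed

end

section \<open>The Toda hierarchy\<close>

text \<open>Raising the indices in \<open>I\<close> by one creates no repetition among
  \<open>0, ..., N - 1\<close> exactly when \<open>I\<close> is closed under successors below
  \<open>N\<close>; this identifies those sets.\<close>

lemma up_closed_eq_interval:
  fixes N :: nat
  assumes "I \<subseteq> {..<N}" and up: "\<And>j. j \<in> I \<Longrightarrow> Suc j < N \<Longrightarrow> Suc j \<in> I"
  shows "I = {N - card I..<N}"
proof (cases "I = {}")
  case False
  have fin: "finite I" using assms(1) finite_subset by blast
  define m where "m = Min I"
  have m: "m \<in> I" "m < N" using Min_in[OF fin False] assms(1) by (auto simp: m_def)
  have "j \<in> I" if "m \<le> j" "j < N" for j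
    using that by (induction j rule: dec_induct) (auto simp: m up)
  moreover have "m \<le> j" if "j \<in> I" for j
    using Min_le[OF fin that] by (simp add: m_def)
  ultimately have I: "I = {m..<N}" using assms(1) by auto
  show ?thesis using m unfolding I by simp
qed simp

definition gap :: "nat \<Rightarrow> nat \<Rightarrow> nat list" where
  "gap n l = [0..<l] @ [Suc l..<Suc (2 * n)]"

lemma length_gap: "l \<le> 2 * n \<Longrightarrow> length (gap n l) = 2 * n"
  by (simp add: gap_def)

lemma gap_nth: "l \<le> 2 * n \<Longrightarrow> j < 2 * n \<Longrightarrow> gap n l ! j = (if j < l then j else Suc j)"
  by (auto simp: gap_def nth_append simp del: upt_Suc)

lemma gap_top: "gap n (2 * n) = [0..<2 * n]"
  by (simp add: gap_def)

context moments
begin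

lemma tpf_not_distinct: "even (length L) \<Longrightarrow> \<not> distinct L \<Longrightarrow> tpf L t = 0"
  by (simp add: tpf_def pf_not_distinct)

text \<open>If \<open>j\<close> is in \<open>I\<close> but \<open>Suc j\<close> is not, both
  positions carry \<open>Suc j\<close> and the Pfaffian vanishes. Otherwise \<open>I\<close> is a
  final segment, and raising it leaves out just its least element.\<close>

lemma tpf_raise_indicator:
  assumes "I \<subseteq> {..<2 * n}"
  shows "tpf (raise n (\<Sum>j\<in>I. Poly_Mapping.single j 1)) t =
    (if I = {2 * n - card I..<2 * n} then tpf (gap n (2 * n - card I)) t else 0)"
proof -
  let ?L = "raise n (\<Sum>j\<in>I. Poly_Mapping.single j 1)"
  have fin: "finite I" using assms finite_subset by blast
  have "Poly_Mapping.lookup (\<Sum>j\<in>I. Poly_Mapping.single j (Suc 0)) a = (\<Sum>j\<in>I. if j = a then Suc 0 else 0)" for a :: nat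
    by (simp add: lookup_sum lookup_single when_def)
  then have L: "length ?L = 2 * n" "\<And>a. a < 2 * n \<Longrightarrow> ?L ! a = (if a \<in> I then Suc a else a)"
    using fin by (auto simp: raise_def)
  show ?thesis
  proof (cases "I = {2 * n - card I..<2 * n}")
    case True
    have "a \<in> I \<longleftrightarrow> \<not> a < 2 * n - card I" if "a < 2 * n" for a
      using that by (subst True) auto
    then have "?L = gap n (2 * n - card I)"
      by (intro nth_equalityI) (auto simp: L[unfolded One_nat_def] length_gap gap_nth)
    with True show ?thesis by simp
  next
    case False
    with up_closed_eq_interval[OF assms] obtain j where j: "j \<in> I" "Suc j < 2 * n" "Suc j \<notin> I" by blast
    then have "?L ! j = ?L ! Suc j" using L(2)[of j] L(2)[of "Suc j"] by simp
    with j(2) L(1) have "\<not> distinct ?L"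
      by (metis Suc_lessD distinct_conv_nth n_not_Suc_n)
    with False L(1) show ?thesis by (simp add: tpf_not_distinct)
  qed
qed

lemma schur_op_tau:
  assumes "t \<in> T"
  shows "schur_op (int k) (tau \<mu> (int n)) t = (if k \<le> 2 * n then (- 1) ^ k * tpf (gap n (2 * n - k)) t else 0)"
proof -
  let ?II = "{I. I \<subseteq> {..<2 * n} \<and> card I = k}"
  have neg: "(- 1) ^ k = poly_const ((- 1) ^ k)"
    by (induction k) (simp_all add: poly_const_def mult_single single_uminus)
  have "schur_op (int k) (tau \<mu> (int n)) t =
      act n ((- 1) ^ k * (\<Sum>I\<in>?II. Poly_Mapping.single (\<Sum>j\<in>I. Poly_Mapping.single j 1) 1)) t"
    unfolding tau_act schur_op_act[OF assms] schur_eval_power_sum by simp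
  also have "\<dots> = (- 1) ^ k * (\<Sum>I\<in>?II. tpf (raise n (\<Sum>j\<in>I. Poly_Mapping.single j 1)) t)"
    unfolding act_def neg lin_const_mult by (simp add: lin_sum lin_single)
  also have "(\<Sum>I\<in>?II. tpf (raise n (\<Sum>j\<in>I. Poly_Mapping.single j 1)) t) =
      (\<Sum>I\<in>?II. if I = {2 * n - k..<2 * n} then tpf (gap n (2 * n - k)) t else 0)"
  proof (rule sum.cong[OF refl])
    fix I assume "I \<in> ?II"
    then have I: "I \<subseteq> {..<2 * n}" "card I = k" by auto
    show "tpf (raise n (\<Sum>j\<in>I. Poly_Mapping.single j 1)) t =
        (if I = {2 * n - k..<2 * n} then tpf (gap n (2 * n - k)) t else 0)"
      using tpf_raise_indicator[OF I(1), of t] unfolding I(2) .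
  qed
  also have "\<dots> = (if {2 * n - k..<2 * n} \<in> ?II then tpf (gap n (2 * n - k)) t else 0)"
    by (subst sum.delta) auto
  \<comment> \<open>For \<open>k > 2 * n\<close> the truncated difference is 0, and the segment has
    \<open>2 * n\<close> elements instead of \<open>k\<close>.\<close>
  also have "{2 * n - k..<2 * n} \<in> ?II \<longleftrightarrow> k \<le> 2 * n"
    by auto
  finally show ?thesis by simp
qed

lemma tau_tpf: "tau \<mu> (int n) = tpf [0..<2 * n]"
  by (auto simp: fun_eq_iff tau_def tpf_def pf_def intro!: pfaffian_cong)

lemma time_deriv_scale_tpf:
  "l \<ge> 1 \<Longrightarrow> t \<in> T \<Longrightarrow> even (length L) \<Longrightarrow>
    time_deriv l (\<lambda>s. c * tpf L s) t = c * time_deriv l (tpf L) t"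
  unfolding time_deriv_tpf unfolding time_deriv_def
  by (rule DERIV_imp_deriv) (intro DERIV_cmult tpf_has_derivative)

text \<open>Raising any index but the last makes it collide with its successor.\<close>

lemma time_deriv_tau:
  assumes "n \<ge> 1" "t \<in> T"
  shows "time_deriv 1 (tpf [0..<2 * n]) t = tpf (gap n (2 * n - 1)) t"
proof -
  let ?L = "[0..<2 * n]"
  have z: "tpf (?L[j := ?L ! j + 1]) t = 0" if j: "j \<in> {..<2 * n} - {2 * n - 1}" for j
  proof (rule tpf_not_distinct)
    have "(?L[j := ?L ! j + 1]) ! j = (?L[j := ?L ! j + 1]) ! Suc j" using j by auto
    moreover have "j < 2 * n" "Suc j < 2 * n" using j by auto
    ultimately show "\<not> distinct (?L[j := ?L ! j + 1])"
      by (metis diff_zero distinct_conv_nth length_list_update length_upt n_not_Suc_n)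
  qed simp
  have "time_deriv 1 (tpf ?L) t = (\<Sum>j<2 * n. tpf (?L[j := ?L ! j + 1]) t)"
    using assms(2) by (subst time_deriv_tpf) auto
  also have "\<dots> = tpf (?L[2 * n - 1 := ?L ! (2 * n - 1) + 1]) t +
      (\<Sum>j\<in>{..<2 * n} - {2 * n - 1}. tpf (?L[j := ?L ! j + 1]) t)"
    using assms(1) by (intro sum.remove) auto
  also have "(\<Sum>j\<in>{..<2 * n} - {2 * n - 1}. tpf (?L[j := ?L ! j + 1]) t) = 0"
    using z by (rule sum.neutral[OF ballI])
  also have "?L[2 * n - 1 := ?L ! (2 * n - 1) + 1] = gap n (2 * n - 1)"
    using assms(1) by (intro nth_equalityI) (auto simp: length_gap gap_nth nth_list_update)
  finally show ?thesis by simp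
qed

text \<open>Only two indices can be raised without a collision: \<open>l - 1\<close>, which moves
  into the gap, and the last index \<open>2 * n\<close>.\<close>

lemma time_deriv_gap:
  assumes l: "1 \<le> l" "l < 2 * n" and t: "t \<in> T"
  shows "time_deriv 1 (tpf (gap n l)) t =
    tpf (gap n (l - 1)) t + tpf ([0..<l] @ [Suc l..<2 * n] @ [2 * n + 1]) t"
proof -
  let ?L = "gap n l"
  have len: "length ?L = 2 * n" using l by (simp add: length_gap)
  have nth: "?L ! j = (if j < l then j else Suc j)" if "j < 2 * n" for j
    using l that by (simp add: gap_nth)
  have z: "tpf (?L[j := ?L ! j + 1]) t = 0" if j: "j \<in> {..<2 * n} - {l - 1} - {2 * n - 1}" for j
  proof (rule tpf_not_distinct)
    have "(?L[j := ?L ! j + 1]) ! j = (?L[j := ?L ! j + 1]) ! Suc j" using j l by (auto simp: len nth)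
    moreover have "j < 2 * n" "Suc j < 2 * n" using j by auto
    ultimately show "\<not> distinct (?L[j := ?L ! j + 1])"
      by (metis distinct_conv_nth length_list_update len n_not_Suc_n)
  qed (simp add: len)
  have "time_deriv 1 (tpf ?L) t = (\<Sum>j<2 * n. tpf (?L[j := ?L ! j + 1]) t)"
    using t by (subst time_deriv_tpf) (auto simp: len)
  also have "\<dots> = tpf (?L[l - 1 := ?L ! (l - 1) + 1]) t +
      (\<Sum>j\<in>{..<2 * n} - {l - 1}. tpf (?L[j := ?L ! j + 1]) t)"
    using l by (intro sum.remove) auto
  also have "(\<Sum>j\<in>{..<2 * n} - {l - 1}. tpf (?L[j := ?L ! j + 1]) t) =
      tpf (?L[2 * n - 1 := ?L ! (2 * n - 1) + 1]) t +
      (\<Sum>j\<in>{..<2 * n} - {l - 1} - {2 * n - 1}. tpf (?L[j := ?L ! j + 1]) t)"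
    using l by (intro sum.remove) auto
  also have "(\<Sum>j\<in>{..<2 * n} - {l - 1} - {2 * n - 1}. tpf (?L[j := ?L ! j + 1]) t) = 0"
    using z by (rule sum.neutral[OF ballI])
  also have "?L[l - 1 := ?L ! (l - 1) + 1] = gap n (l - 1)"
    using l by (intro nth_equalityI) (auto simp: length_gap gap_nth nth_list_update)
  also have "?L[2 * n - 1 := ?L ! (2 * n - 1) + 1] = [0..<l] @ [Suc l..<2 * n] @ [2 * n + 1]"
    using l by (intro nth_equalityI) (auto simp: length_gap gap_nth nth_list_update nth_append)
  finally show ?thesis by simp
qed

end

section \<open>The Toda equation for Toeplitz moments\<close>

locale toeplitz_moments = moments +
  assumes skew: "\<And>i j t. t \<in> T \<Longrightarrow> \<mu> i j t = - \<mu> j i t"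
    and shift: "\<And>i j t. t \<in> T \<Longrightarrow> \<mu> (Suc i) (Suc j) t = \<mu> i j t"
begin

lemma tpf_map_Suc: 
  assumes "t \<in> T"
  shows "tpf (map Suc L) t = tpf L t"
  unfolding tpf_def pf_def by (auto intro!: pfaffian_cong simp: shift[OF assms])

text \<open>This is \<open>pf_pluecker\<close> with \<open>0, l, 2 * n, 2 * n + 1\<close> for
  \<open>a, b, c, d\<close>. In each product one factor lacks the index 0, and the Toeplitz property
  lowers all its indices by one. Each product has \<open>l\<close> in exactly one factor, so sorting
  multiplies all of them by the same sign \<open>e\<close>.\<close>

lemma toda_pfaffian_identity:
  assumes l: "1 \<le> l" "l < 2 * n" and t: "t \<in> T"
  shows "tpf (gap (n - 1) (l - 1)) t * tpf [0..<2 * n + 2] t =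
    tpf [0..<2 * n] t * tpf (gap n (l - 1)) t - tpf (gap n l) t * tpf (gap n (2 * n - 1)) t
      + tpf ([0..<l] @ [Suc l..<2 * n] @ [2 * n + 1]) t * tpf [0..<2 * n] t"
proof -
  let ?A = "\<lambda>i j. \<mu> i j t"
  define K where "K = [1..<l] @ [Suc l..<2 * n]"
  \<comment> \<open>The sign for moving \<open>l\<close> past the \<open>l - 1\<close> entries
    \<open>1, ..., l - 1\<close>.\<close>
  define e :: real where "e = (- 1) ^ (l - 1)"
  have even: "even (length K)" using l by (simp add: K_def)
  have l0: "[0..<l] = 0 # [1..<l]" using l by (simp add: upt_conv_Cons)
  have mid: "[1..<l] @ l # [Suc l..<2 * n] = [1..<2 * n]"
    using l upt_add_eq_append[of 1 l "2 * n - l"] by (simp add: upt_conv_Cons)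
  \<comment> \<open>Crossing \<open>K\<close> costs no sign because its length is even.\<close>
  have push: "pf ?A (xs @ K @ x # zs) = pf ?A (xs @ x # K @ zs)" if "even (length (xs @ x # zs))" for xs x zs
    using pf_move[of xs x K zs ?A] that even by simp
  have ins: "pf ?A (xs @ [1..<2 * n] @ zs) = e * pf ?A (xs @ l # K @ zs)" if "odd (length (xs @ zs))" for xs zs
    using pf_move[of xs l "[1..<l]" "[Suc l..<2 * n] @ zs" ?A] that l
    unfolding mid[symmetric] by (simp add: K_def e_def)
  have K: "pf ?A K = tpf (gap (n - 1) (l - 1)) t"
  proof -
    have "K = map Suc (gap (n - 1) (l - 1))"
    proof -
      have "Suc (Suc (2 * (n - Suc 0))) = 2 * n" using l by auto
      then show ?thesis using l by (simp add: K_def gap_def map_Suc_upt del: upt_Suc)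
    qed
    then show ?thesis using tpf_map_Suc[OF t] by (simp add: tpf_def)
  qed
  have ab: "e * pf ?A (0 # l # K) = tpf [0..<2 * n] t"
    using ins[of "[0]" "[]"] l by (simp add: tpf_def upt_conv_Cons)
  have cd: "pf ?A (2 * n # (2 * n + 1) # K) = tpf (gap n (l - 1)) t"
  proof -
    have "K @ [2 * n, 2 * n + 1] = map Suc (gap n (l - 1))"
      using l by (simp add: K_def gap_def map_Suc_upt)
    then show ?thesis
      using tpf_map_Suc[OF t, of "gap n (l - 1)"] push[of "[]" "2 * n" "[2 * n + 1]"] push[of "[2 * n]" "2 * n + 1" "[]"]
      by (simp add: tpf_def)
  qed
  have ac: "pf ?A (0 # 2 * n # K) = tpf (gap n l) t"
    using push[of "[0]" "2 * n" "[]"] l by (simp add: tpf_def gap_def l0 K_def)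
  have bd: "e * pf ?A (l # (2 * n + 1) # K) = tpf (gap n (2 * n - 1)) t"
  proof -
    have "[1..<2 * n] @ [2 * n + 1] = map Suc (gap n (2 * n - 1))"
      using l by (simp add: gap_def map_Suc_upt)
    then show ?thesis
      using tpf_map_Suc[OF t, of "gap n (2 * n - 1)"] push[of "[l]" "2 * n + 1" "[]"] ins[of "[]" "[2 * n + 1]"]
      by (simp add: tpf_def)
  qed
  have ad: "pf ?A (0 # (2 * n + 1) # K) = tpf ([0..<l] @ [Suc l..<2 * n] @ [2 * n + 1]) t"
    using push[of "[0]" "2 * n + 1" "[]"] l by (simp add: tpf_def l0 K_def)
  have bc: "e * pf ?A (l # 2 * n # K) = tpf [0..<2 * n] t"
  proof -
    have "[1..<2 * n] @ [2 * n] = map Suc [0..<2 * n]"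
      using l by (simp add: map_Suc_upt)
    then show ?thesis
      using tpf_map_Suc[OF t, of "[0..<2 * n]"] push[of "[l]" "2 * n" "[]"] ins[of "[]" "[2 * n]"]
      by (simp add: tpf_def)
  qed
  have abcd: "e * pf ?A (0 # l # 2 * n # (2 * n + 1) # K) = tpf [0..<2 * n + 2] t"
  proof -
    have "[0..<2 * n + 2] = 0 # [1..<2 * n] @ [2 * n, 2 * n + 1]"
      using l by (simp add: upt_conv_Cons)
    then show ?thesis
      using push[of "[0, l]" "2 * n" "[2 * n + 1]"] push[of "[0, l, 2 * n]" "2 * n + 1" "[]"]
        ins[of "[0]" "[2 * n, 2 * n + 1]"]
      by (simp add: tpf_def)
  qed
  have "pf ?A K * (e * pf ?A (0 # l # 2 * n # (2 * n + 1) # K)) =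
    (e * pf ?A (0 # l # K)) * pf ?A (2 * n # (2 * n + 1) # K)
      - pf ?A (0 # 2 * n # K) * (e * pf ?A (l # (2 * n + 1) # K))
      + pf ?A (0 # (2 * n + 1) # K) * (e * pf ?A (l # 2 * n # K))"
    using arg_cong[OF pf_pluecker[of ?A K 0 l "2 * n" "2 * n + 1", OF skew[OF t] even], of "\<lambda>x. e * x"]
    by (simp only: algebra_simps)
  then show ?thesis
    unfolding K ab bc bd abcd cd ac ad .
qed

lemma hirota_eq_0:
  assumes "t \<in> T" "\<And>s. s \<in> T \<Longrightarrow> g s = f s"
  shows "hirota 1 f g t = 0"
  using time_deriv_cong[OF domain assms(1), of 1 g f] assms by (simp add: hirota_def)

text \<open>At both ends of the range of \<open>l\<close> the Schur operator returns the tau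
  function itself, so the Hirota derivative vanishes, and so does the right side. In between, the
  equation is \<open>toda_pfaffian_identity\<close> up to sign.\<close>

lemma toda:
  assumes l: "l \<le> 2 * n" and t: "t \<in> T"
  shows "hirota 1 (tau \<mu> (int n)) (schur_op (2 * int n - int l) (tau \<mu> (int n))) t =
    tau \<mu> (int n + 1) t * schur_op (2 * int n - 1 - int l) (tau \<mu> (int n - 1)) t"
proof -
  have idx: "2 * int n - int l = int (2 * n - l)" using l by simp
  have S: "schur_op (2 * int n - int l) (tau \<mu> (int n)) s = (- 1) ^ l * tpf (gap n l) s" if "s \<in> T" for s
  proof -
    have "(- 1 :: real) ^ (2 * n - l) = (- 1) ^ l" using l by (simp add: minus_one_power_iff)
    then show ?thesis using schur_op_tau[OF that, of "2 * n - l" n] l unfolding idx by simp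
  qed
  consider "l = 2 * n" | "l = 0" "n \<ge> 1" | "1 \<le> l" "l < 2 * n" using l by linarith
  then show ?thesis
  proof cases
    case 1
    \<comment> \<open>The Schur polynomial of index -1 is 0. Stating this for every \<open>f\<close>
      includes \<open>n = 0\<close>, where the operator is applied to
      \<open>tau \<mu> (-1)\<close>.\<close>
    have "schur_op (2 * int n - 1 - int l) f t = 0" for f
      by (simp add: 1 schur_op_def poly_subst_op_def schur_poly_def)
    moreover have "hirota 1 (tau \<mu> (int n)) (schur_op (2 * int n - int l) (tau \<mu> (int n))) t = 0"
      by (rule hirota_eq_0[OF t]) (subst S, auto simp: 1 gap_top tau_tpf)
    ultimately show ?thesis by simp
  next
    case 2
    \<comment> \<open>Leaving out 0 gives the list of the tau function shifted by one, with the same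
      Pfaffian.\<close>
    have "gap n 0 = map Suc [0..<2 * n]" by (simp add: gap_def map_Suc_upt del: upt_Suc)
    then have "hirota 1 (tau \<mu> (int n)) (schur_op (2 * int n - int l) (tau \<mu> (int n))) t = 0"
      by (intro hirota_eq_0[OF t]) (subst S, auto simp: 2 tau_tpf tpf_map_Suc)
    moreover have "schur_op (2 * int n - 1 - int l) (tau \<mu> (int n - 1)) t = 0"
    proof -
      have "2 * int n - 1 - int l = int (2 * n - 1)" "int n - 1 = int (n - 1)" using 2 by auto
      \<comment> \<open>The degree \<open>2 * n - 1\<close> exceeds the number
        \<open>2 * (n - 1)\<close> of indices.\<close>
      then show ?thesis using schur_op_tau[OF t, of "2 * n - 1" "n - 1"] 2 by simp
    qed
    ultimately show ?thesis by simp
  next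
    case 3
    have R: "schur_op (2 * int n - 1 - int l) (tau \<mu> (int n - 1)) t = - ((- 1) ^ l) * tpf (gap (n - 1) (l - 1)) t"
    proof -
      have k: "2 * int n - 1 - int l = int (2 * n - 1 - l)" "int n - 1 = int (n - 1)" using 3 by auto
      have "2 * (n - 1) - (2 * n - 1 - l) = l - 1" "2 * n - 1 - l \<le> 2 * (n - 1)" using 3 by auto
      moreover have "(- 1 :: real) ^ (2 * n - 1 - l) = - ((- 1) ^ l)"
        using 3 by (auto simp: minus_one_power_iff)
      ultimately show ?thesis using schur_op_tau[OF t, of "2 * n - 1 - l" "n - 1"] unfolding k by simp
    qed
    have "int n + 1 = int (n + 1)" by simp
    then have tau1: "tau \<mu> (int n + 1) t = tpf [0..<2 * n + 2] t" by (simp only: tau_tpf) simp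
    have len: "even (length (gap n l))" using l by (simp add: length_gap)
    have "time_deriv 1 (schur_op (2 * int n - int l) (tau \<mu> (int n))) t =
        time_deriv 1 (\<lambda>s. (- 1) ^ l * tpf (gap n l) s) t"
      by (rule time_deriv_cong[OF domain t]) (auto simp: S)
    also have "\<dots> = (- 1) ^ l * (tpf (gap n (l - 1)) t + tpf ([0..<l] @ [Suc l..<2 * n] @ [2 * n + 1]) t)"
      using time_deriv_scale_tpf[OF _ t len, of 1] time_deriv_gap[OF 3 t] by simp
    finally have D: "time_deriv 1 (schur_op (2 * int n - int l) (tau \<mu> (int n))) t =
      (- 1) ^ l * (tpf (gap n (l - 1)) t + tpf ([0..<l] @ [Suc l..<2 * n] @ [2 * n + 1]) t)" .
    have "n \<ge> 1" using 3 by simp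
    then show ?thesis
      unfolding hirota_def D R tau1 S[OF t] unfolding tau_tpf
      using time_deriv_tau[OF _ t] arg_cong[OF toda_pfaffian_identity[OF 3 t], of "\<lambda>x. - ((- 1) ^ l) * x"]
      by (simp add: algebra_simps)
  qed
qed

end

theorem mainTheorem5:
  fixes \<mu> :: "nat \<Rightarrow> nat \<Rightarrow> times \<Rightarrow> real" and T :: "times set"
  assumes "times_domain T"
    and smooth: "\<And>i j. smooth_in_times T (\<mu> i j)"
    and skew: "\<And>i j t. t \<in> T \<Longrightarrow> \<mu> i j t = - \<mu> j i t"
    and evolution: "\<And>n i j t. n \<ge> 1 \<Longrightarrow> t \<in> T \<Longrightarrow>
          time_deriv n (\<mu> i j) t = \<mu> (i + n) j t + \<mu> i (j + n) t"
    and shift: "\<And>i j t. i \<ge> 1 \<Longrightarrow> j \<ge> 1 \<Longrightarrow> t \<in> T \<Longrightarrow> \<mu> i j t = \<mu> (i - 1) (j - 1) t"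
    and nonzero: "\<And>(n::nat) t. t \<in> T \<Longrightarrow> tau \<mu> (int n) t \<noteq> 0"
  shows "\<forall>(n::nat) (l::nat). l \<le> 2 * n \<longrightarrow> (\<forall>t\<in>T.
           hirota 1 (tau \<mu> (int n)) (schur_op (2 * int n - int l) (tau \<mu> (int n))) t =
           tau \<mu> (int n + 1) t * schur_op (2 * int n - 1 - int l) (tau \<mu> (int n - 1)) t)"
proof -
  interpret toeplitz_moments \<mu> T
  proof
    show "times_domain T" by fact
    fix l i j :: nat and t :: times assume l: "l \<ge> 1" and t: "t \<in> T"
    \<comment> \<open>Smoothness for the empty list of derivatives. It is what turns the evolution
      equation, stated with \<open>deriv\<close>, into the existence of the derivative.\<close>
    have "(\<lambda>x. \<mu> i j (t(l := x))) differentiable (at (t l))"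
      using smooth[of i j] l t unfolding smooth_in_times_def by (auto dest: spec[of _ "[]"])
    then have "((\<lambda>x. \<mu> i j (t(l := x))) has_real_derivative time_deriv l (\<mu> i j) t) (at (t l))"
      by (simp add: time_deriv_def DERIV_deriv_iff_real_differentiable)
    then show "((\<lambda>x. \<mu> i j (t(l := x))) has_real_derivative \<mu> (i + l) j t + \<mu> i (j + l) t) (at (t l))"
      by (simp add: evolution[OF l t])
  next
    fix i j :: nat and t :: times assume t: "t \<in> T"
    show "\<mu> i j t = - \<mu> j i t" by (rule skew[OF t])
    show "\<mu> (Suc i) (Suc j) t = \<mu> i j t" using shift[of "Suc i" "Suc j" t] t by simp
  qed
  show ?thesis using toda by blast
qed

end
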